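(* Let $\Phi=(\phi_1,\phi_2)$, where $\phi_\ell=\widetilde p_\ell/p_\ell$, $\ell=1,2$, are rational inner functions on $\mathbb{D}^2$. Assume that there exist $\alpha_1,\alpha_2\in\mathbb{T}$ and a closed arc $J\subset\mathbb{T}$ of positive length such that $g^{\alpha_1}_{j_1}(\zeta)=g^{\alpha_2}_{j_2}(\zeta)$ for all $\zeta\in J$ and some indices $j_1,j_2$, where $(\zeta,g^{\alpha_\ell}_{j_\ell}(\zeta))$ is a parametrization of (a branch of) the level set $\mathcal{C}_{\alpha_\ell}(\phi_\ell)$, and that $J$ avoids the $z_1$-coordinates of the (possible) singularities of $\phi_1,\phi_2$. Then $C_\Phi:A^2_\beta(\mathbb{D}^2)\to A^2_\beta(\mathbb{D}^2)$ is not bounded, for all $\beta\ge-1$.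
   Context: $\mathbb{D}^2$ is the unit bidisc in $\mathbb{C}^2$, $\mathbb{T}^2$ the bitorus. For $\beta>-1$, $A^2_\beta(\mathbb{D}^2)$ is the space of holomorphic $f$ on $\mathbb{D}^2$ with $\int_{\mathbb{D}^2}|f|^2(1-|z_1|^2)^\beta(1-|z_2|^2)^\beta dV<\infty$, where $dV=dA\times dA$ and $dA=\frac1\pi dx\,dy$; for $\beta=-1$, $A^2_{-1}(\mathbb{D}^2)=H^2(\mathbb{D}^2)$ is the Hardy space. $C_\Phi f=f\circ\Phi$. Rational inner functions (RIFs) are of the form $\phi=\widetilde p/p$ with $p\in\mathbb{C}[z_1,z_2]$ of bidegree $(n,m)$ stable (no zeros in $\mathbb{D}^2$) and $\widetilde p(z_1,z_2)=z_1^nz_2^m\overline{p(1/\overline{z_1},1/\overline{z_2})}$. A singularity is a point of $\mathbb{T}^2$ where $p$ vanishes (with $p,\widetilde p$ without common factors). $\phi$ has a non-tangential limit $\phi^*(\zeta)\in\mathbb{T}$ at every $\zeta\in\mathbb{T}^2$, and for $\alpha\in\mathbb{T}$ the level set is $\mathcal{C}_\alpha(\phi)=\mathrm{clos}\{\zeta\in\mathbb{T}^2:\phi^*(\zeta)=\alpha\}$. Parametrization of level sets: for each $\alpha\in\mathbb{T}$ and any choice of $\tau_0\in\mathbb{T}$ there are finitely many functions $g_1^\alpha,\dots,g_N^\alpha:\mathbb{T}\to\mathbb{T}$ (with $N$ the degree of $\phi$ in $z_2$), analytic on $\mathbb{T}\setminus\{\tau_0\}$, such that $\mathcal{C}_\alpha(\phi)$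 is the union of the graphs $\{(\zeta,g_j^\alpha(\zeta)):\zeta\in\mathbb{T}\}$, possibly together with finitely many vertical lines $\zeta_1=\tau_i$, $\tau_i\in\mathbb{T}$. In the claim, $g^{\alpha_\ell}_{j}$ denotes such functions for $\mathcal{C}_{\alpha_\ell}(\phi_\ell)$. *)

theory Defs
  imports "HOL-Analysis.Analysis" "HOL-Computational_Algebra.Polynomial"
begin

section \<open>Bidisc, bitorus, holomorphic functions of two variables\<close>

abbreviation circle :: "complex set"
  where "circle \<equiv> sphere 0 1"

definition bidisc :: "(complex \<times> complex) set"
  where "bidisc = ball 0 1 \<times> ball 0 1"

definition bitorus :: "(complex \<times> complex) set"
  where "bitorus = circle \<times> circle"

text \<open>The real Frechet derivative is required to be complex linear at each point.\<close>

definition holomorphic2_on :: "(complex \<times> complex \<Rightarrow> complex) \<Rightarrow> (complex \<times> complex) set \<Rightarrow> bool"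
    (infixl "holomorphic2'_on" 50)
  where "f holomorphic2_on S \<longleftrightarrow>
    (\<forall>z\<in>S. \<exists>a b. (f has_derivative (\<lambda>h. a * fst h + b * snd h)) (at z within S))"


section \<open>The spaces $A^2_\beta$ and composition operators\<close>

definition dA :: "complex measure"
  where "dA = scale_measure (ennreal (1 / pi)) lborel"

definition dV :: "(complex \<times> complex) measure"
  where "dV = dA \<Otimes>\<^sub>M dA"

definition bergman_norm_sq :: "real \<Rightarrow> (complex \<times> complex \<Rightarrow> complex) \<Rightarrow> ennreal"
  where "bergman_norm_sq \<beta> f =
    (\<integral>\<^sup>+z\<in>bidisc. ennreal ((cmod (f z))\<^sup>2 * (1 - (cmod (fst z))\<^sup>2) powr \<beta>
                                       * (1 - (cmod (snd z))\<^sup>2) powr \<beta>) \<partial>dV)"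

definition hardy_norm_sq :: "(complex \<times> complex \<Rightarrow> complex) \<Rightarrow> ennreal"
  where "hardy_norm_sq f =
    (SUP r\<in>{0<..<1::real}. \<integral>\<^sup>+(s, t)\<in>{0..2*pi} \<times> {0..2*pi}.
       ennreal ((cmod (f (of_real r * cis s, of_real r * cis t)))\<^sup>2 / (2 * pi)\<^sup>2) \<partial>lborel)"

definition A2_norm_sq :: "real \<Rightarrow> (complex \<times> complex \<Rightarrow> complex) \<Rightarrow> ennreal"
  where "A2_norm_sq \<beta> f = (if \<beta> = -1 then hardy_norm_sq f else bergman_norm_sq \<beta> f)"

text \<open>Members are total functions; only their values on the bidisc matter.  Only
  \<open>\<beta> \<ge> -1\<close> is meaningful.\<close>

definition A2 :: "real \<Rightarrow> (complex \<times> complex \<Rightarrow> complex) set"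
  where "A2 \<beta> = {f. f holomorphic2_on bidisc \<and> A2_norm_sq \<beta> f < \<infinity>}"

definition A2_norm :: "real \<Rightarrow> (complex \<times> complex \<Rightarrow> complex) \<Rightarrow> real"
  where "A2_norm \<beta> f = sqrt (enn2real (A2_norm_sq \<beta> f))"

definition bounded_composition_operator ::
    "real \<Rightarrow> (complex \<times> complex \<Rightarrow> complex \<times> complex) \<Rightarrow> bool"
  where "bounded_composition_operator \<beta> \<Phi> \<longleftrightarrow>
    (\<forall>f\<in>A2 \<beta>. f \<circ> \<Phi> \<in> A2 \<beta>) \<and>
    (\<exists>C. \<forall>f\<in>A2 \<beta>. A2_norm \<beta> (f \<circ> \<Phi>) \<le> C * A2_norm \<beta> f)"


section \<open>Rational inner functions\<close>

text \<open>An element of \<open>\<complex>[z\<^sub>1, z\<^sub>2]\<close> is a polynomial in \<open>z\<^sub>2\<close> with coefficients in \<open>\<complex>[z\<^sub>1]\<close>: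
  the coefficient of \<open>z\<^sub>1^i z\<^sub>2^j\<close> is \<open>coeff (coeff p j) i\<close>.\<close>

definition eval2 :: "complex poly poly \<Rightarrow> complex \<times> complex \<Rightarrow> complex"
  where "eval2 p z = poly (poly p [:snd z:]) (fst z)"

definition bidegree_le :: "complex poly poly \<Rightarrow> nat \<Rightarrow> nat \<Rightarrow> bool"
  where "bidegree_le p n m \<longleftrightarrow> degree p \<le> m \<and> (\<forall>j. degree (coeff p j) \<le> n)"

text \<open>The reflection \<open>z\<^sub>1^n z\<^sub>2^m cnj (p (1 / cnj z\<^sub>1, 1 / cnj z\<^sub>2))\<close>, given by its coefficients
  so that it is a polynomial; \<open>eval2_reflection\<close> recovers the formula.\<close>

definition reflection :: "nat \<Rightarrow> nat \<Rightarrow> complex poly poly \<Rightarrow> complex poly poly"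
  where "reflection n m p =
    (\<Sum>j\<le>m. monom (\<Sum>i\<le>n. monom (cnj (coeff (coeff p (m - j)) (n - i))) i) j)"

lemma eval2_eq_sum:
  assumes "bidegree_le p n m"
  shows "eval2 p z = (\<Sum>j\<le>m. \<Sum>i\<le>n. coeff (coeff p j) i * fst z ^ i * snd z ^ j)"
proof -
  have a: "poly q x = (\<Sum>i\<le>N. coeff q i * x ^ i)" if "degree q \<le> N"
    for q :: "'a::comm_semiring_1 poly" and x N
    unfolding poly_altdef
    by (rule sum.mono_neutral_left) (use that in \<open>auto simp: coeff_eq_0\<close>)
  have "eval2 p z = poly (\<Sum>j\<le>m. coeff p j * [:snd z:] ^ j) (fst z)"
    using assms unfolding eval2_def bidegree_le_def by (subst a[of p m]) auto
  also have "\<dots> = (\<Sum>j\<le>m. poly (coeff p j) (fst z) * snd z ^ j)"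
    by (simp add: poly_sum)
  also have "\<dots> = (\<Sum>j\<le>m. \<Sum>i\<le>n. coeff (coeff p j) i * fst z ^ i * snd z ^ j)"
    using assms unfolding bidegree_le_def
    by (intro sum.cong refl) (simp add: a[of _ n] sum_distrib_right)
  finally show ?thesis .
qed

lemma eval2_reflection:
  assumes "bidegree_le p n m" "z1 \<noteq> 0" "z2 \<noteq> 0"
  shows "eval2 (reflection n m p) (z1, z2) =
         z1 ^ n * z2 ^ m * cnj (eval2 p (1 / cnj z1, 1 / cnj z2))"
proof -
  have rev: "(\<Sum>i\<le>k. f i) = (\<Sum>i\<le>k. f (k - i))" for f :: "nat \<Rightarrow> complex" and k :: nat
    by (rule sum.reindex_bij_witness[of _ "\<lambda>i. k - i" "\<lambda>i. k - i"]) auto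
  have "eval2 (reflection n m p) (z1, z2) =
    (\<Sum>j\<le>m. \<Sum>i\<le>n. cnj (coeff (coeff p (m - j)) (n - i)) * z1 ^ i * z2 ^ j)"
    unfolding eval2_def reflection_def
    by (simp add: poly_sum poly_monom sum_distrib_right)
  also have "\<dots> = (\<Sum>j\<le>m. \<Sum>i\<le>n. cnj (coeff (coeff p j) i) * z1 ^ (n - i) * z2 ^ (m - j))"
    by (subst (1 2) rev) simp
  also have "\<dots> = z1 ^ n * z2 ^ m * cnj (eval2 p (1 / cnj z1, 1 / cnj z2))"
    using assms(2,3)
    by (simp add: eval2_eq_sum[OF assms(1)] sum_distrib_left power_diff field_simps)
  finally show ?thesis .
qed

text \<open>Here \<open>(n, m)\<close> is the bidegree at which \<open>p\<close> is reflected, and the actual bidegree of \<open>p\<close>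
  may be smaller; otherwise rational inner functions such as \<open>z\<^sub>1 z\<^sub>2\<close> (\<open>p = 1\<close>, reflected at
  \<open>(1, 1)\<close>) would not be of the form \<open>\<phi> = reflection n m p / p\<close>.  As \<open>p\<close> is stable, the
  reflection has degree exactly \<open>m\<close> in \<open>z\<^sub>2\<close>; hence \<open>m\<close> is the degree of \<open>\<phi>\<close> in \<open>z\<^sub>2\<close>.\<close>

definition rif_denominator :: "nat \<Rightarrow> nat \<Rightarrow> complex poly poly \<Rightarrow> bool"
  where "rif_denominator n m p \<longleftrightarrow>
    bidegree_le p n m \<and> (\<forall>z\<in>bidisc. eval2 p z \<noteq> 0) \<and> coprime p (reflection n m p)"

definition rif :: "nat \<Rightarrow> nat \<Rightarrow> complex poly poly \<Rightarrow> complex \<times> complex \<Rightarrow> complex"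
  where "rif n m p z = eval2 (reflection n m p) z / eval2 p z"

definition rif_singularities :: "complex poly poly \<Rightarrow> (complex \<times> complex) set"
  where "rif_singularities p = {\<zeta>\<in>bitorus. eval2 p \<zeta> = 0}"


section \<open>Level sets and their parametrizations\<close>

text \<open>Non-tangential approach regions in the bidisc, with respect to the maximum norm.\<close>

definition nontangential_region :: "real \<Rightarrow> complex \<times> complex \<Rightarrow> (complex \<times> complex) set"
  where "nontangential_region c \<zeta> =
    {z\<in>bidisc. max (cmod (fst z - fst \<zeta>)) (cmod (snd z - snd \<zeta>))
              \<le> c * (1 - max (cmod (fst z)) (cmod (snd z)))}"

definition has_nontangential_limit ::
    "(complex \<times> complex \<Rightarrow> complex) \<Rightarrow> complex \<Rightarrow> complex \<times> complex \<Rightarrow> bool"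
  where "has_nontangential_limit f l \<zeta> \<longleftrightarrow>
    (\<forall>c>0. (f \<longlongrightarrow> l) (at \<zeta> within nontangential_region c \<zeta>))"

definition level_set :: "(complex \<times> complex \<Rightarrow> complex) \<Rightarrow> complex \<Rightarrow> (complex \<times> complex) set"
  where "level_set \<phi> \<alpha> = closure {\<zeta>\<in>bitorus. has_nontangential_limit \<phi> \<alpha> \<zeta>}"

text \<open>\<open>g\<close> is only meaningful on the circle, whereas \<open>analytic_on\<close> refers to a neighbourhood;
  hence the extension \<open>h\<close>.  \<open>T\<close> is the set of base points of the vertical lines.\<close>

definition level_set_parametrization ::
    "(complex \<times> complex \<Rightarrow> complex) \<Rightarrow> complex \<Rightarrow> complex \<Rightarrow> nat \<Rightarrow> (nat \<Rightarrow> complex \<Rightarrow> complex) \<Rightarrow> bool"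
  where "level_set_parametrization \<phi> \<alpha> \<tau>\<^sub>0 N g \<longleftrightarrow>
    (\<forall>j\<in>{1..N}. g j ` circle \<subseteq> circle \<and>
       (\<exists>h. h analytic_on (circle - {\<tau>\<^sub>0}) \<and> (\<forall>\<zeta>\<in>circle - {\<tau>\<^sub>0}. h \<zeta> = g j \<zeta>))) \<and>
    (\<exists>T. finite T \<and> T \<subseteq> circle \<and>
       level_set \<phi> \<alpha> = (\<Union>j\<in>{1..N}. {(\<zeta>, g j \<zeta>) |\<zeta>. \<zeta> \<in> circle}) \<union> T \<times> circle)"

definition closed_arc :: "complex set \<Rightarrow> bool"
  where "closed_arc J \<longleftrightarrow> (\<exists>a b. a < b \<and> b \<le> a + 2 * pi \<and> J = cis ` {a..b})"

end

theory Submission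
  imports Defs
begin

text \<open>
  The operator fails to map \<open>A\<^sup>2\<^sub>\<beta>\<close> into itself, and one function shows it:
  \<open>f(z) = ((1 - cnj \<alpha>\<^sub>1 z\<^sub>1) (1 - cnj \<alpha>\<^sub>2 z\<^sub>2))^(- G / 2)\<close> with \<open>\<beta> + 3/2 < G < \<beta> + 2\<close>.
  Since \<open>G < \<beta> + 2\<close>, both one-variable factors are square integrable, so \<open>f\<close> is in \<open>A\<^sup>2\<^sub>\<beta>\<close>.
  Both \<open>\<alpha>\<^sub>1 - \<phi>\<^sub>1\<close> and \<open>\<alpha>\<^sub>2 - \<phi>\<^sub>2\<close> vanish on the common curve, which stays away from the
  singularities, so \<open>\<bar>f \<circ> \<Phi>\<bar>\<^sup>2\<close> is at least of order \<open>\<delta>^(- 2 G)\<close> at distance \<open>\<delta>\<close> from the curve. Within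
  distance \<open>\<delta>\<close> there are about \<open>1/\<delta>\<close> disjoint boxes of weighted volume \<open>\<delta>^(4 + 2 \<beta>)\<close> each,
  hence the squared norm of \<open>f \<circ> \<Phi>\<close> dominates \<open>\<delta>^(3 + 2 \<beta> - 2 G)\<close>, which is unbounded as
  \<open>2G > 2\<beta> + 3\<close>.
\<close>

section \<open>Integrability of the test function\<close>

text \<open>The value \<open>\<infinity>\<close> at \<open>0\<close> replaces the junk value \<open>0 powr q = 0\<close>, so that upper bounds by
  \<open>kern\<close> hold at the singular point as well.\<close>

definition kern :: "real \<Rightarrow> real \<Rightarrow> real \<Rightarrow> ennreal"
  where "kern R q u = (if u = 0 then \<infinity> else ennreal (\<bar>u\<bar> powr q)) * indicator {-R..R} u"

lemma kern_measurable [measurable]: "kern R q \<in> borel_measurable borel"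
  unfolding kern_def[abs_def] by measurable

lemma kern_eq: "u \<noteq> 0 \<Longrightarrow> \<bar>u\<bar> \<le> R \<Longrightarrow> kern R q u = ennreal (\<bar>u\<bar> powr q)"
  by (auto simp: kern_def indicator_def)

text \<open>Almost everywhere, \<open>kern\<close> is a power on \<open>{0..R}\<close> plus its
  mirror image. The half on \<open>{0..R}\<close> has an explicit integral since
  \<open>q > -1\<close>, and the other half follows by reflection. The point 0, where
  \<open>kern\<close> is infinite, is a null set.\<close>

lemma nn_integral_kern_finite:
  assumes "q > -1" "R \<ge> 0"
  shows "(\<integral>\<^sup>+u. kern R q u \<partial>lborel) < \<infinity>"
proof -
  define h where "h u = (if u \<in> {0..R} then u powr q else 0)" for u :: real
  have [measurable]: "h \<in> borel_measurable borel"
    unfolding h_def[abs_def] by measurable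
  have h0: "h u \<ge> 0" for u
    by (simp add: h_def)
  have "(h has_integral (R powr (q + 1) / (q + 1))) UNIV"
    unfolding h_def[abs_def]
    by (subst has_integral_restrict_UNIV) (rule has_integral_powr_from_0[OF assms])
  from nn_integral_has_integral_lborel[OF _ h0 this]
  have 1: "(\<integral>\<^sup>+u. ennreal (h u) \<partial>lborel) < \<infinity>"
    by simp
  have 2: "(\<integral>\<^sup>+u. ennreal (h (- u)) \<partial>lborel) < \<infinity>"
    using 1 by (subst (asm) nn_integral_real_affine[where c = "-1" and t = 0]) auto
  have "(\<integral>\<^sup>+u. kern R q u \<partial>lborel) \<le> (\<integral>\<^sup>+u. ennreal (h u) + ennreal (h (- u)) \<partial>lborel)"
  proof (rule nn_integral_mono_AE)
    show "AE u in lborel. kern R q u \<le> ennreal (h u) + ennreal (h (- u))"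
      using AE_lborel_singleton[of "0::real"]
    proof eventually_elim
      case (elim u)
      then show ?case
        by (cases "u \<ge> 0") (auto simp: kern_def h_def indicator_def)
    qed
  qed
  also have "\<dots> < \<infinity>"
    using 1 2 by (subst nn_integral_add) auto
  finally show ?thesis .
qed

lemma nn_integral_kern_affine:
  assumes "\<bar>c\<bar> = 1"
  shows "(\<integral>\<^sup>+x. kern R q (t + c * x) \<partial>lborel) = (\<integral>\<^sup>+u. kern R q u \<partial>lborel)"
  using assms by (subst (2) nn_integral_real_affine[where c = c and t = t]) auto

section \<open>Fubini for Lebesgue measure on the complex plane in real and imaginary parts\<close>

lemma lborel_complex_eq_distr:
  "lborel = distr (lborel \<Otimes>\<^sub>M lborel) borel (\<lambda>(x, y). Complex x y)"
proof (rule lborel_eqI)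
  have [measurable]: "(\<lambda>(x, y). Complex x y) \<in> borel \<rightarrow>\<^sub>M borel"
    by (intro borel_measurable_continuous_onI)
       (auto simp: case_prod_unfold Complex_eq intro!: continuous_intros)
  fix l u :: complex
  assume le: "\<And>b. b \<in> Basis \<Longrightarrow> l \<bullet> b \<le> u \<bullet> b"
  have "(\<lambda>(x, y). Complex x y) -` box l u = box (Re l) (Re u) \<times> box (Im l) (Im u)"
    by (auto simp: in_box_complex_iff)
  then show "emeasure (distr (lborel \<Otimes>\<^sub>M lborel) borel (\<lambda>(x, y). Complex x y)) (box l u)
      = (\<Prod>b\<in>Basis. (u - l) \<bullet> b)"
    using le[of 1] le[of \<i>]
    by (simp add: emeasure_distr lborel_prod space_pair_measure)
       (simp add: lborel_prod[symmetric] lborel.emeasure_pair_measure_Times Basis_complex_def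
                  ennreal_mult inner_complex_def)
qed simp

lemma Complex_measurable [measurable]:
  "(\<lambda>(x, y). Complex x y) \<in> borel_measurable (lborel \<Otimes>\<^sub>M lborel)"
  by (simp add: lborel_prod)
     (intro borel_measurable_continuous_onI,
      auto simp: case_prod_unfold Complex_eq intro!: continuous_intros)

text \<open>Both orders of integration are provided because the majorant on the disc is a sum of two
  terms. One is integrated first over the real part, the other first over the imaginary
  part.\<close>

lemma nn_integral_complex:
  assumes [measurable]: "F \<in> borel_measurable borel"
  shows "(\<integral>\<^sup>+z. F z \<partial>lborel) = (\<integral>\<^sup>+y. \<integral>\<^sup>+x. F (Complex x y) \<partial>lborel \<partial>lborel)"
    and "(\<integral>\<^sup>+z. F z \<partial>lborel) = (\<integral>\<^sup>+x. \<integral>\<^sup>+y. F (Complex x y) \<partial>lborel \<partial>lborel)"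
proof -
  have m: "(\<lambda>(x, y). F (Complex x y)) \<in> borel_measurable (lborel \<Otimes>\<^sub>M lborel)"
    using measurable_compose[OF Complex_measurable assms] by (simp add: case_prod_unfold)
  have "(\<integral>\<^sup>+z. F z \<partial>lborel) = (\<integral>\<^sup>+w. F (Complex (fst w) (snd w)) \<partial>(lborel \<Otimes>\<^sub>M lborel))"
    by (subst lborel_complex_eq_distr, subst nn_integral_distr)
       (auto simp: case_prod_unfold intro: Complex_measurable)
  then have *: "(\<integral>\<^sup>+z. F z \<partial>lborel) = (\<integral>\<^sup>+(x, y). F (Complex x y) \<partial>(lborel \<Otimes>\<^sub>M lborel))"
    by (simp add: case_prod_unfold)
  show "(\<integral>\<^sup>+z. F z \<partial>lborel) = (\<integral>\<^sup>+x. \<integral>\<^sup>+y. F (Complex x y) \<partial>lborel \<partial>lborel)"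
    using lborel.nn_integral_fst[OF m] unfolding * by simp
  show "(\<integral>\<^sup>+z. F z \<partial>lborel) = (\<integral>\<^sup>+y. \<integral>\<^sup>+x. F (Complex x y) \<partial>lborel \<partial>lborel)"
    using lborel_pair.nn_integral_snd[OF m] unfolding * by simp
qed

text \<open>Here \<open>1 - x\<^sup>2 - y\<^sup>2 = (s - \<bar>x\<bar>) (s + \<bar>x\<bar>)\<close> with \<open>s = sqrt (1 - y\<^sup>2)\<close> bounded below.  The bound
  separates into a function of \<open>y\<close> and a translate in \<open>x\<close>, which is what Fubini needs.\<close>

lemma powr_le_kern:
  fixes a x y v A :: real
  assumes "x\<^sup>2 + y\<^sup>2 < 1" "\<bar>y\<bar> \<le> 9/10" "\<bar>a\<bar> \<le> 1" "\<bar>a - y\<bar> \<le> v" "0 < v" "0 < A" "A \<le> 1"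
  shows "ennreal ((v * (1 - x\<^sup>2 - y\<^sup>2)) powr (- A)) \<le>
    3 * kern 2 (- A) (a - y) *
      (kern 2 (- A) (sqrt (1 - y\<^sup>2) - x) + kern 2 (- A) (sqrt (1 - y\<^sup>2) + x))"
proof -
  define s where "s = sqrt (1 - y\<^sup>2)"
  have y2: "y\<^sup>2 \<le> (9/10)\<^sup>2"
    using power_mono[OF assms(2), of 2] by simp
  have s2: "s\<^sup>2 = 1 - y\<^sup>2"
    using y2 by (auto simp: s_def power2_eq_square)
  have s: "2/5 \<le> s"
    unfolding s_def using y2 by (intro real_le_rsqrt) (simp add: power2_eq_square)
  have s1: "s \<le> 1"
    by (simp add: s_def)
  have xs: "\<bar>x\<bar> < s"
  proof (rule power2_less_imp_less)
    show "\<bar>x\<bar>\<^sup>2 < s\<^sup>2"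
      unfolding s2 using assms(1) by simp
  qed (use s in simp)
  have "ennreal ((s - \<bar>x\<bar>) powr (- A)) = kern 2 (- A) (s - \<bar>x\<bar>)"
    using xs s1 by (simp add: kern_eq)
  also have "\<dots> \<le> kern 2 (- A) (s - x) + kern 2 (- A) (s + x)"
    by (cases "x \<ge> 0") simp_all
  finally have K: "ennreal ((s - \<bar>x\<bar>) powr (- A)) \<le> kern 2 (- A) (s - x) + kern 2 (- A) (s + x)" .
  \<comment> \<open>For \<open>a = y\<close> the factor \<open>kern 2 (- A) (a - y)\<close> is
    infinite, but infinity times 0 is 0 in \<open>ennreal\<close>. Hence the other factor has to be
    shown positive.\<close>
  have "0 < ennreal ((s - \<bar>x\<bar>) powr (- A))"
    using xs by simp
  with K have pos: "0 < kern 2 (- A) (s - x) + kern 2 (- A) (s + x)"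
    by (rule less_le_trans[rotated])
  show ?thesis
  proof (cases "a = y")
    case True
    then have "kern 2 (- A) (a - y) = \<infinity>"
      by (simp add: kern_def)
    with pos have "3 * kern 2 (- A) (a - y) * (kern 2 (- A) (s - x) + kern 2 (- A) (s + x)) = \<infinity>"
      by (simp only: ennreal_mult_top ennreal_top_mult zero_less_iff_neq_zero infinity_ennreal_def) simp
    then show ?thesis
      by (simp add: s_def)
  next
    case False
    have fac: "1 - x\<^sup>2 - y\<^sup>2 = (s - \<bar>x\<bar>) * (s + \<bar>x\<bar>)"
    proof -
      have "(s - \<bar>x\<bar>) * (s + \<bar>x\<bar>) = s\<^sup>2 - \<bar>x\<bar>\<^sup>2"
        by (simp add: algebra_simps power2_eq_square)
      then show ?thesis
        using s2 by simp
    qed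
    \<comment> \<open>This combines \<open>\<bar>a - y\<bar> \<le> v\<close> with
      \<open>2/5 \<le> s + \<bar>x\<bar>\<close>. The negative exponent then reverses the
      inequality, and the factor \<open>(2/5) powr (- A)\<close> is at most 5/2 because
      \<open>A \<le> 1\<close>.\<close>
    have "2/5 * (\<bar>a - y\<bar> * (s - \<bar>x\<bar>)) = \<bar>a - y\<bar> * ((s - \<bar>x\<bar>) * (2/5))"
      by simp
    also have "\<dots> \<le> v * (1 - x\<^sup>2 - y\<^sup>2)"
      unfolding fac using assms s xs by (intro mult_mono) auto
    finally have le: "2/5 * (\<bar>a - y\<bar> * (s - \<bar>x\<bar>)) \<le> v * (1 - x\<^sup>2 - y\<^sup>2)" .
    have "(v * (1 - x\<^sup>2 - y\<^sup>2)) powr (- A) \<le> (2/5 * (\<bar>a - y\<bar> * (s - \<bar>x\<bar>))) powr (- A)"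
      using le False xs assms by (intro powr_mono2') auto
    also have "\<dots> = (2/5) powr (- A) * (\<bar>a - y\<bar> * (s - \<bar>x\<bar>)) powr (- A)"
      by (rule powr_mult; use xs in simp)
    also have "(\<bar>a - y\<bar> * (s - \<bar>x\<bar>)) powr (- A) = \<bar>a - y\<bar> powr (- A) * (s - \<bar>x\<bar>) powr (- A)"
      by (rule powr_mult; use xs in simp)
    also have "(2/5) powr (- A) * (\<bar>a - y\<bar> powr (- A) * (s - \<bar>x\<bar>) powr (- A))
        \<le> 3 * (\<bar>a - y\<bar> powr (- A) * (s - \<bar>x\<bar>) powr (- A))"
    proof (intro mult_right_mono)
      have "(2/5::real) powr (- A) \<le> (2/5) powr (- 1)"
        using assms by (intro powr_mono') auto
      then show "(2/5::real) powr (- A) \<le> 3"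
        by (simp add: powr_minus)
    qed auto
    finally have "ennreal ((v * (1 - x\<^sup>2 - y\<^sup>2)) powr (- A)) \<le>
        ennreal (3 * (\<bar>a - y\<bar> powr (- A) * (s - \<bar>x\<bar>) powr (- A)))"
      by (rule ennreal_leI)
    also have "\<dots> = 3 * ennreal (\<bar>a - y\<bar> powr (- A)) * ennreal ((s - \<bar>x\<bar>) powr (- A))"
      by (simp add: ennreal_mult mult.assoc)
    also have "\<dots> \<le> 3 * kern 2 (- A) (a - y) * (kern 2 (- A) (s - x) + kern 2 (- A) (s + x))"
      using assms False K by (intro mult_mono) (auto simp: kern_eq)
    finally show ?thesis
      by (simp add: s_def)
  qed
qed

lemma nn_integral_dA: "f \<in> borel_measurable borel \<Longrightarrow>
    (\<integral>\<^sup>+z. f z \<partial>dA) = ennreal (1 / pi) * (\<integral>\<^sup>+z. f z \<partial>lborel)"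
  unfolding dA_def by (rule nn_integral_scale_measure) simp

text \<open>Put \<open>v = cmod (\<alpha> - z)\<close>, \<open>w = 1 - (cmod z)\<^sup>2\<close>,
  \<open>A = 1 - \<epsilon>\<close> and \<open>b = \<beta> + A\<close>. The integrand is
  \<open>(v * w) powr (- A) * (w / v) powr b\<close>. As \<open>w \<le> 2 * v\<close> and
  \<open>b \<ge> 0\<close>, the second factor is bounded. The first has singularities of order
  \<open>A < 1\<close> only, and \<open>powr_le_kern\<close> separates them into integrable
  functions of one real variable.\<close>

lemma nn_integral_disc_powr_finite:
  fixes \<alpha> :: complex and \<beta> \<epsilon> :: real
  assumes "\<alpha> \<in> circle" "0 < \<epsilon>" "\<epsilon> < 1" "\<epsilon> \<le> \<beta> + 1"
  shows "(\<integral>\<^sup>+z. ennreal (cmod (\<alpha> - z) powr (- (\<beta> + 2 - 2 * \<epsilon>)) * (1 - (cmod z)\<^sup>2) powr \<beta>)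
            * indicator (ball 0 1) z \<partial>dA) < \<infinity>"
proof -
  define A where "A = 1 - \<epsilon>"
  have A: "0 < A" "A < 1"
    using assms by (auto simp: A_def)
  define b where "b = \<beta> + A"
  have b: "b \<ge> 0"
    using assms by (simp add: b_def A_def)
  define k where "k = kern 2 (- A)"
  have [measurable]: "k \<in> borel_measurable borel"
    unfolding k_def by measurable
  define W where "W = (\<integral>\<^sup>+u. k u \<partial>lborel)"
  have W: "W < \<infinity>"
    unfolding W_def k_def using A by (intro nn_integral_kern_finite) auto
  have Wc: "(\<integral>\<^sup>+x. k (t + x) \<partial>lborel) = W" "(\<integral>\<^sup>+x. k (t - x) \<partial>lborel) = W" for t
    using nn_integral_kern_affine[of 1 2 "-A" t] nn_integral_kern_affine[of "-1" 2 "-A" t]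
    by (simp_all add: W_def k_def)
  \<comment> \<open>\<open>powr_le_kern\<close> needs one coordinate of modulus at most 9/10. Such a
    coordinate exists at every point of the disc, but it can be either one, so \<open>M\<close> adds
    the two versions of the bound.\<close>
  define H where "H a y x = k (a - y) * (k (sqrt (1 - y\<^sup>2) - x) + k (sqrt (1 - y\<^sup>2) + x))"
    for a x y
  define M where "M z = H (Im \<alpha>) (Im z) (Re z) + H (Re \<alpha>) (Re z) (Im z)" for z
  have [measurable]: "(\<lambda>z. H (Im \<alpha>) (Im z) (Re z)) \<in> borel_measurable borel"
    "(\<lambda>z. H (Re \<alpha>) (Re z) (Im z)) \<in> borel_measurable borel"
    unfolding H_def by measurable
  have [measurable]: "M \<in> borel_measurable borel"
    unfolding M_def[abs_def] by measurable
  have HI: "(\<integral>\<^sup>+y. \<integral>\<^sup>+x. H a y x \<partial>lborel \<partial>lborel) = W * (W + W)" for a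
    unfolding H_def by (simp add: nn_integral_cmult nn_integral_add Wc nn_integral_multc)
  have "(\<integral>\<^sup>+z. M z \<partial>lborel) = W * (W + W) + W * (W + W)"
    unfolding M_def
    by (subst nn_integral_add, simp, simp, subst nn_integral_complex(1), simp,
        subst nn_integral_complex(2)) (simp_all add: HI)
  then have M: "(\<integral>\<^sup>+z. M z \<partial>lborel) < \<infinity>"
    using W by (simp add: ennreal_mult_less_top)
  have pt: "ennreal (cmod (\<alpha> - z) powr (- (\<beta> + 2 - 2 * \<epsilon>)) * (1 - (cmod z)\<^sup>2) powr \<beta>)
            * indicator (ball 0 1) z \<le> ennreal (2 powr b) * 3 * M z" for z
  proof (cases "z \<in> ball 0 1")
    case True
    define x y where "x = Re z" and "y = Im z"
    define v w where "v = cmod (\<alpha> - z)" and "w = 1 - (cmod z)\<^sup>2"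
    have z1: "cmod z < 1" and a1: "cmod \<alpha> = 1"
      using True assms by auto
    have xy: "x\<^sup>2 + y\<^sup>2 < 1" "w = 1 - x\<^sup>2 - y\<^sup>2"
      using z1 by (auto simp: x_def y_def w_def cmod_power2[symmetric] power2_less_imp_less
          abs_square_less_1)
        (simp add: cmod_power2)
    have w: "w > 0"
      using xy by simp
    have v1: "1 - cmod z \<le> v"
      using norm_triangle_ineq2[of \<alpha> z] a1 by (simp add: v_def)
    then have v: "v > 0"
      using z1 by simp
    have "w = (1 - cmod z) * (1 + cmod z)"
      by (simp add: w_def power2_eq_square algebra_simps)
    also have "\<dots> \<le> v * 2"
      using v1 z1 by (intro mult_mono) auto
    finally have wv: "w / v \<le> 2"
      using v by (simp add: field_simps)
    have e: "- (\<beta> + 2 - 2 * \<epsilon>) = - A - b" "\<beta> = b - A"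
      by (simp_all add: A_def b_def)
    have "v powr (- A - b) * w powr (b - A) = (v powr (- A) * w powr (- A)) * (w powr b / v powr b)"
      by (simp add: powr_diff powr_minus divide_inverse)
    also have "\<dots> = (v * w) powr (- A) * (w / v) powr b"
      using v w by (simp add: powr_mult powr_divide)
    finally have "v powr (- (\<beta> + 2 - 2 * \<epsilon>)) * w powr \<beta> = (v * w) powr (- A) * (w / v) powr b"
      unfolding e(1) by (subst (1) e(2)) 
    also have "\<dots> \<le> (v * w) powr (- A) * 2 powr b"
      using wv v w b by (intro mult_left_mono powr_mono2) auto
    finally have 1: "ennreal (v powr (- (\<beta> + 2 - 2 * \<epsilon>)) * w powr \<beta>) \<le>
        ennreal (2 powr b) * ennreal ((v * w) powr (- A))"
      by (subst ennreal_mult[symmetric]) (auto intro!: ennreal_leI simp: mult.commute)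
    have "\<bar>y\<bar> \<le> 9/10 \<or> \<bar>x\<bar> \<le> 9/10"
    proof (rule ccontr)
      assume "\<not> (\<bar>y\<bar> \<le> 9/10 \<or> \<bar>x\<bar> \<le> 9/10)"
      then have "(9/10)\<^sup>2 < \<bar>x\<bar>\<^sup>2" "(9/10)\<^sup>2 < \<bar>y\<bar>\<^sup>2"
        by (intro power_strict_mono; simp)+
      with xy(1) show False
        by (simp add: power2_eq_square)
    qed
    then have "ennreal ((v * w) powr (- A)) \<le> 3 * M z"
    proof
      assume y: "\<bar>y\<bar> \<le> 9/10"
      have "ennreal ((v * w) powr (- A)) \<le> 3 * H (Im \<alpha>) y x"
        unfolding xy(2) H_def k_def mult.assoc[symmetric]
        using A v a1 abs_Im_le_cmod[of \<alpha>] abs_Im_le_cmod[of "\<alpha> - z"]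
        by (intro powr_le_kern xy(1) y) (auto simp: v_def y_def)
      also have "\<dots> \<le> 3 * M z"
        by (intro mult_left_mono) (auto simp: M_def x_def y_def)
      finally show ?thesis .
    next
      assume x: "\<bar>x\<bar> \<le> 9/10"
      have xy': "y\<^sup>2 + x\<^sup>2 < 1" "w = 1 - y\<^sup>2 - x\<^sup>2"
        using xy by auto
      have "ennreal ((v * w) powr (- A)) \<le> 3 * H (Re \<alpha>) x y"
        unfolding xy'(2) H_def k_def mult.assoc[symmetric]
        using A v a1 abs_Re_le_cmod[of \<alpha>] abs_Re_le_cmod[of "\<alpha> - z"]
        by (intro powr_le_kern xy'(1) x) (auto simp: v_def x_def)
      also have "\<dots> \<le> 3 * M z"
        by (intro mult_left_mono) (auto simp: M_def x_def y_def)
      finally show ?thesis .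
    qed
    then have "ennreal (2 powr b) * ennreal ((v * w) powr (- A)) \<le> ennreal (2 powr b) * (3 * M z)"
      by (rule mult_left_mono) simp
    with 1 True show ?thesis
      by (simp add: v_def w_def mult.assoc)
  qed simp
  have "(\<integral>\<^sup>+z. ennreal (cmod (\<alpha> - z) powr (- (\<beta> + 2 - 2 * \<epsilon>)) * (1 - (cmod z)\<^sup>2) powr \<beta>)
            * indicator (ball 0 1) z \<partial>dA) \<le> (\<integral>\<^sup>+z. ennreal (2 powr b) * 3 * M z \<partial>dA)"
    by (rule nn_integral_mono) (rule pt)
  also have "\<dots> = ennreal (1 / pi) * (ennreal (2 powr b) * 3 * (\<integral>\<^sup>+z. M z \<partial>lborel))"
    by (simp add: nn_integral_dA nn_integral_cmult)
  also have "\<dots> < \<infinity>"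
    using M by (simp add: ennreal_mult_less_top)
  finally show ?thesis .
qed

section \<open>Chord length on the circle and uniform integrals of powers over concentric
  circles\<close>

lemma sin_ge_quarter:
  fixes u :: real
  assumes "0 \<le> u" "u \<le> pi / 2"
  shows "u / 4 \<le> sin u"
proof -
  \<comment> \<open>On \<open>{0..1}\<close> the derivative \<open>cos v - 1/2\<close> of
    \<open>sin v - v/2\<close> is nonnegative, because \<open>1 < pi / 3\<close>. Beyond 1,
    monotonicity of the sine gives at least 1/2, which exceeds \<open>u / 4\<close> as
    \<open>u \<le> pi / 2 < 2\<close>.\<close>
  have A: "v / 2 \<le> sin v" if v: "0 \<le> v" "v \<le> 1" for v :: real
  proof -
    have "sin 0 - 0 / 2 \<le> sin v - v / 2"
    proof (rule DERIV_nonneg_imp_nondecreasing[OF v(1)])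
      fix x :: real assume x: "0 \<le> x" "x \<le> v"
      have "cos (pi / 3) \<le> cos x"
        using x v pi_gt3 by (intro cos_monotone_0_pi_le) auto
      then have "0 \<le> cos x - 1 / 2"
        by (simp add: cos_60)
      moreover have "((\<lambda>u. sin u - u / 2) has_real_derivative cos x - 1 / 2) (at x)"
        by (auto intro!: derivative_eq_intros)
      ultimately show "\<exists>y. ((\<lambda>u. sin u - u / 2) has_real_derivative y) (at x) \<and> 0 \<le> y"
        by blast
    qed
    then show ?thesis
      by simp
  qed
  show ?thesis
  proof (cases "u \<le> 1")
    case True
    then show ?thesis
      using A[of u] assms by simp
  next
    case False
    have "1 / 2 \<le> sin (1::real)"
      using A[of 1] by simp
    also have "\<dots> \<le> sin u"
      using False assms by (intro sin_monotone_2pi_le) auto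
    finally show ?thesis
      using assms pi_half_less_two by simp
  qed
qed

text \<open>The squares of both sides equal \<open>2 - 2 * cos (s - t)\<close>, by the subtraction
  and half-angle formulas.\<close>

lemma cmod_cis_diff: "cmod (cis s - cis t) = 2 * \<bar>sin ((s - t) / 2)\<bar>"
proof -
  have "(cmod (cis s - cis t))\<^sup>2 = (2 * \<bar>sin ((s - t) / 2)\<bar>)\<^sup>2"
  proof -
    have "(cmod (cis s - cis t))\<^sup>2 =
        ((cos s)\<^sup>2 + (sin s)\<^sup>2) + ((cos t)\<^sup>2 + (sin t)\<^sup>2) - 2 * (cos s * cos t + sin s * sin t)"
      unfolding cmod_power2 by (simp add: power2_eq_square algebra_simps)
    also have "\<dots> = 2 - 2 * cos (s - t)"
      by (simp add: cos_diff)
    also have "\<dots> = (2 * \<bar>sin ((s - t) / 2)\<bar>)\<^sup>2"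
    proof -
      have "2 * ((s - t) / 2) = s - t"
        by simp
      then have "cos (s - t) = 1 - 2 * (sin ((s - t) / 2))\<^sup>2"
        using cos_double_sin[of "(s - t) / 2"] by (simp only:)
      then show ?thesis
        by (simp add: power_mult_distrib)
    qed
    finally show ?thesis .
  qed
  then show ?thesis
    by (rule power2_eq_imp_eq) auto
qed

lemma cmod_cis_diff_ge:
  assumes "\<bar>s - t\<bar> \<le> pi"
  shows "\<bar>s - t\<bar> / 4 \<le> cmod (cis s - cis t)"
proof -
  have "\<bar>(s - t) / 2\<bar> / 4 \<le> sin \<bar>(s - t) / 2\<bar>"
    using assms by (intro sin_ge_quarter) auto
  then show ?thesis
    unfolding cmod_cis_diff by (auto simp: abs_if minus_divide_left[symmetric] split: if_splits)
qed

lemma cmod_cis_diff_le: "cmod (cis s - cis t) \<le> \<bar>s - t\<bar>"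
  unfolding cmod_cis_diff using abs_sin_x_le_abs_x[of "(s - t) / 2"] by simp

lemma circle_eq_cis:
  assumes "z \<in> circle"
  obtains t where "0 \<le> t" "t < 2 * pi" "z = cis t"
proof -
  have "z = cis (Arg2pi z)"
    using assms Arg2pi_eq[of z] by (simp add: cis_conv_exp)
  then show ?thesis
    using that[of "Arg2pi z"] Arg2pi_ge_0[of z] Arg2pi_lt_2pi[of z] by blast
qed

text \<open>The bound is uniform in \<open>r\<close> because moving from \<open>r * cis s\<close>
  out to \<open>cis s\<close> costs \<open>1 - r\<close>, which is itself at most the distance from
  \<alpha> to \<open>r * cis s\<close>. Hence that distance is at least half the chord from \<alpha>
  to \<open>cis s\<close>, and so at least an eighth of the angle between them. A power of the angle
  with exponent above -1 is integrable.\<close>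

lemma nn_integral_circle_powr_bounded:
  fixes \<alpha> :: complex and G :: real
  assumes "\<alpha> \<in> circle" "0 < G" "G < 1"
  shows "\<exists>C<\<infinity>. \<forall>r\<in>{0<..<1}.
    (\<integral>\<^sup>+s. ennreal (cmod (\<alpha> - of_real r * cis s) powr (- G)) * indicator {0..2*pi} s \<partial>lborel) \<le> C"
proof -
  obtain \<theta> where \<theta>: "0 \<le> \<theta>" "\<theta> < 2 * pi" "\<alpha> = cis \<theta>"
    using circle_eq_cis[OF assms(1)] by blast
  define k where "k = kern pi (- G)"
  have [measurable]: "k \<in> borel_measurable borel"
    unfolding k_def by measurable
  define W where "W = (\<integral>\<^sup>+u. k u \<partial>lborel)"
  have W: "W < \<infinity>"
    unfolding W_def k_def using assms by (intro nn_integral_kern_finite) auto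
  have Wc: "(\<integral>\<^sup>+x. k (t + x) \<partial>lborel) = W" for t
    using nn_integral_kern_affine[of 1 pi "-G" t] by (simp add: W_def k_def)
  \<comment> \<open>The angle \<open>s - \<theta>\<close> lies between \<open>- 2 * pi\<close> and
    \<open>2 * pi\<close>. One of the three translates brings it to modulus at most
    \<open>pi\<close>, where the chord estimate applies.\<close>
  define M where "M s = k (- \<theta> + s) + k (- \<theta> - 2 * pi + s) + k (- \<theta> + 2 * pi + s)" for s
  have [measurable]: "M \<in> borel_measurable borel"
    unfolding M_def[abs_def] by measurable
  have M: "(\<integral>\<^sup>+s. M s \<partial>lborel) = W + W + W"
    unfolding M_def by (simp add: nn_integral_add Wc del: add_uminus_conv_diff uminus_add_conv_diff)
  have pt: "ennreal (cmod (\<alpha> - of_real r * cis s) powr (- G)) * indicator {0..2*pi} s \<le> 8 * M s"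
    if r: "0 < r" "r < 1" for r s
  proof (cases "s \<in> {0..2*pi}")
    case True
    have "\<exists>u\<in>{- \<theta> + s, - \<theta> - 2 * pi + s, - \<theta> + 2 * pi + s}. \<bar>u\<bar> \<le> pi"
      using True \<theta> by (auto simp: abs_le_iff)
    then obtain u where u: "u \<in> {- \<theta> + s, - \<theta> - 2 * pi + s, - \<theta> + 2 * pi + s}" "\<bar>u\<bar> \<le> pi"
      by blast
    have cu: "cis (\<theta> + u) = cis s"
    proof -
      have "\<theta> + u = s \<or> \<theta> + u = s - 2 * pi \<or> \<theta> + u = s + 2 * pi"
        using u(1) by auto
      then show ?thesis
        by (auto simp: complex_eq_iff cos_diff sin_diff)
    qed
    have kM: "k u \<le> M s"
      using u(1) by (auto simp: M_def add_increasing add_increasing2 add.assoc)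
    have "\<bar>u\<bar> / 4 \<le> cmod (cis (\<theta> + u) - cis \<theta>)"
      using cmod_cis_diff_ge[of "\<theta> + u" \<theta>] u by simp
    also have "\<dots> = cmod (\<alpha> - cis s)"
      by (simp add: cu \<theta> norm_minus_commute)
    also have "\<dots> \<le> cmod (\<alpha> - of_real r * cis s) + cmod (of_real r * cis s - cis s)"
      using norm_triangle_ineq[of "\<alpha> - of_real r * cis s" "of_real r * cis s - cis s"] by simp
    also have "cmod (of_real r * cis s - cis s) = 1 - r"
    proof -
      have "of_real r * cis s - cis s = of_real (r - 1) * cis s"
        by (simp add: algebra_simps)
      then show ?thesis
        using r by (simp only: norm_mult norm_cis norm_of_real) simp
    qed
    also have "1 - r \<le> cmod (\<alpha> - of_real r * cis s)"
      using norm_triangle_ineq2[of \<alpha> "of_real r * cis s"] r \<theta> by (simp add: norm_mult)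
    finally have le: "\<bar>u\<bar> / 8 \<le> cmod (\<alpha> - of_real r * cis s)"
      by simp
    have "ennreal (cmod (\<alpha> - of_real r * cis s) powr (- G)) \<le> 8 * k u"
    proof (cases "u = 0")
      case True
      then show ?thesis
        by (simp add: k_def kern_def ennreal_mult_top)
    next
      case False
      have "cmod (\<alpha> - of_real r * cis s) powr (- G) \<le> (\<bar>u\<bar> / 8) powr (- G)"
        using le False assms by (intro powr_mono2') auto
      also have "\<dots> = (1 / 8) powr (- G) * \<bar>u\<bar> powr (- G)"
        using powr_mult[of "1/8" "\<bar>u\<bar>" "- G"] by simp
      also have "\<dots> \<le> 8 * \<bar>u\<bar> powr (- G)"
      proof (intro mult_right_mono)
        have "(1/8::real) powr (- G) \<le> (1/8) powr (- 1)"
          using assms by (intro powr_mono') auto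
        then show "(1/8::real) powr (- G) \<le> 8"
          by (simp add: powr_minus)
      qed auto
      finally have "ennreal (cmod (\<alpha> - of_real r * cis s) powr (- G)) \<le> ennreal (8 * \<bar>u\<bar> powr (- G))"
        by (rule ennreal_leI)
      then show ?thesis
        using False u by (simp add: k_def kern_eq ennreal_mult)
    qed
    also have "\<dots> \<le> 8 * M s"
      by (intro mult_left_mono kM) simp
    finally show ?thesis
      using True by simp
  qed simp
  show ?thesis
  proof (intro exI[of _ "8 * (W + W + W)"] conjI ballI)
    show "8 * (W + W + W) < \<infinity>"
      using W by (simp add: ennreal_mult_less_top)
    fix r :: real assume r: "r \<in> {0<..<1}"
    have "(\<integral>\<^sup>+s. ennreal (cmod (\<alpha> - of_real r * cis s) powr (- G)) * indicator {0..2*pi} s \<partial>lborel)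
        \<le> (\<integral>\<^sup>+s. 8 * M s \<partial>lborel)"
      using r by (intro nn_integral_mono pt) auto
    also have "\<dots> = 8 * (W + W + W)"
      by (simp add: nn_integral_cmult M)
    finally show "(\<integral>\<^sup>+s. ennreal (cmod (\<alpha> - of_real r * cis s) powr (- G)) * indicator {0..2*pi} s \<partial>lborel)
        \<le> 8 * (W + W + W)" .
  qed
qed

section \<open>The test function: modulus and holomorphy\<close>

definition peak :: "real \<Rightarrow> complex \<Rightarrow> complex \<Rightarrow> complex \<times> complex \<Rightarrow> complex"
  where "peak G \<alpha>\<^sub>1 \<alpha>\<^sub>2 z = (1 - cnj \<alpha>\<^sub>1 * fst z) powr of_real (- G / 2) *
                           (1 - cnj \<alpha>\<^sub>2 * snd z) powr of_real (- G / 2)"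

text \<open>For unimodular \<alpha>,
  \<open>\<alpha> * (1 - cnj \<alpha> * w) = \<alpha> - w\<close>, so both differences have the same
  modulus. The exponent \<open>- G / 2\<close> in \<open>peak\<close> is halved so that squaring
  yields \<open>- G\<close>.\<close>

lemma cmod_peak:
  assumes "\<alpha>\<^sub>1 \<in> circle" "\<alpha>\<^sub>2 \<in> circle"
  shows "(cmod (peak G \<alpha>\<^sub>1 \<alpha>\<^sub>2 z))\<^sup>2 = cmod (\<alpha>\<^sub>1 - fst z) powr (- G) * cmod (\<alpha>\<^sub>2 - snd z) powr (- G)"
proof -
  have A: "(cmod ((1 - cnj \<alpha> * w) powr of_real (- G / 2)))\<^sup>2 = cmod (\<alpha> - w) powr (- G)"
    if "\<alpha> \<in> circle" for \<alpha> w
  proof -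
    have "\<alpha> * (1 - cnj \<alpha> * w) = \<alpha> - w"
      using that complex_norm_square[of \<alpha>] by (simp add: algebra_simps)
    then have "cmod (1 - cnj \<alpha> * w) = cmod (\<alpha> - w)"
      using that by (metis mem_sphere_0 mult_1 norm_mult)
    then have "cmod ((1 - cnj \<alpha> * w) powr of_real (- G / 2)) = cmod (\<alpha> - w) powr (- G / 2)"
      by (subst norm_powr_real_powr') auto
    then show ?thesis
      by (simp add: power2_eq_square powr_add[symmetric])
  qed
  show ?thesis
    unfolding peak_def norm_mult power_mult_distrib using A assms by simp
qed

text \<open>On the disc \<open>1 - cnj \<alpha> * w\<close> has positive real part, so it avoids the
  cut of the principal branch and each factor is differentiable. The product rule then gives a
  derivative of the required complex linear form.\<close>

lemma holomorphic2_peak: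
  assumes "\<alpha>\<^sub>1 \<in> circle" "\<alpha>\<^sub>2 \<in> circle"
  shows "peak G \<alpha>\<^sub>1 \<alpha>\<^sub>2 holomorphic2_on bidisc"
proof -
  define h where "h \<alpha> w = (1 - cnj \<alpha> * w) powr of_real (- G / 2)" for \<alpha> w
  have D: "\<exists>d. (h \<alpha> has_field_derivative d) (at w)" if "\<alpha> \<in> circle" "cmod w < 1" for \<alpha> w
  proof -
    have "Re (cnj \<alpha> * w) \<le> cmod (cnj \<alpha> * w)"
      by (rule complex_Re_le_cmod)
    also have "\<dots> < 1"
      using that by (simp add: norm_mult)
    finally have "1 - cnj \<alpha> * w \<notin> \<real>\<^sub>\<le>\<^sub>0"
      by (auto simp: complex_nonpos_Reals_iff)
    then show ?thesis
      unfolding h_def[abs_def] by (auto intro!: exI derivative_eq_intros)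
  qed
  show ?thesis
    unfolding holomorphic2_on_def
  proof
    fix z assume z: "z \<in> bidisc"
    then have z': "cmod (fst z) < 1" "cmod (snd z) < 1"
      by (auto simp: bidisc_def)
    obtain d1 d2 where d: "(h \<alpha>\<^sub>1 has_field_derivative d1) (at (fst z))"
        "(h \<alpha>\<^sub>2 has_field_derivative d2) (at (snd z))"
      using D z' assms by meson
    have 1: "((\<lambda>z. h \<alpha>\<^sub>1 (fst z)) has_derivative (\<lambda>k. d1 * fst k)) (at z within bidisc)"
      using has_derivative_compose[OF has_derivative_fst[OF has_derivative_ident]
        d(1)[unfolded has_field_derivative_def]] .
    have 2: "((\<lambda>z. h \<alpha>\<^sub>2 (snd z)) has_derivative (\<lambda>k. d2 * snd k)) (at z within bidisc)"
      using has_derivative_compose[OF has_derivative_snd[OF has_derivative_ident]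
        d(2)[unfolded has_field_derivative_def]] .
    have "peak G \<alpha>\<^sub>1 \<alpha>\<^sub>2 = (\<lambda>z. h \<alpha>\<^sub>1 (fst z) * h \<alpha>\<^sub>2 (snd z))"
      by (simp add: peak_def h_def fun_eq_iff)
    then have "(peak G \<alpha>\<^sub>1 \<alpha>\<^sub>2 has_derivative
        (\<lambda>k. h \<alpha>\<^sub>1 (fst z) * (d2 * snd k) + d1 * fst k * h \<alpha>\<^sub>2 (snd z))) (at z within bidisc)"
      using has_derivative_mult[OF 1 2] by simp
    then show "\<exists>a b. (peak G \<alpha>\<^sub>1 \<alpha>\<^sub>2 has_derivative (\<lambda>h. a * fst h + b * snd h)) (at z within bidisc)"
      by (intro exI[of _ "d1 * h \<alpha>\<^sub>2 (snd z)"] exI[of _ "h \<alpha>\<^sub>1 (fst z) * d2"])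
         (simp add: algebra_simps)
  qed
qed

section \<open>Area measure, product integrals, and finiteness of the norms of the test
  function\<close>

lemma sets_dA [simp, measurable_cong]: "sets dA = sets borel"
  by (simp add: dA_def)

lemma space_dA [simp]: "space dA = UNIV"
  by (simp add: dA_def space_scale_measure)

lemma emeasure_dA: "emeasure dA A = ennreal (1 / pi) * emeasure lborel A"
  by (simp add: dA_def)

text \<open>Fubini on \<open>dV\<close> rests on this. The scaled measure is rewritten as a constant
  density, for which a criterion for sigma-finiteness exists.\<close>

lemma sigma_finite_dA: "sigma_finite_measure dA"
proof -
  have "dA = density lborel (\<lambda>_. ennreal (1 / pi))"
    by (rule measure_eqI) (simp_all add: emeasure_dA emeasure_density nn_integral_cmult_indicator)
  moreover have "sigma_finite_measure (density lborel (\<lambda>_::complex. ennreal (1 / pi)))"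
    by (subst sigma_finite_measure.sigma_finite_iff_density_finite[OF sigma_finite_lborel]) auto
  ultimately show ?thesis
    by simp
qed

interpretation dA: sigma_finite_measure dA
  by (rule sigma_finite_dA)

lemma (in sigma_finite_measure) nn_integral_pair_mult:
  assumes [measurable]: "f \<in> borel_measurable N" "g \<in> borel_measurable M"
  shows "(\<integral>\<^sup>+z. f (fst z) * g (snd z) \<partial>(N \<Otimes>\<^sub>M M)) = (\<integral>\<^sup>+x. f x \<partial>N) * (\<integral>\<^sup>+y. g y \<partial>M)"
  by (subst nn_integral_fst[symmetric]) (simp_all add: nn_integral_cmult nn_integral_multc)

text \<open>The test function, the weight and the indicator of the bidisc all factor over the two
  variables. The norm is therefore a product of two integrals over the disc, each already known to
  be finite.\<close>

lemma bergman_norm_sq_peak_finite: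
  assumes "\<alpha>\<^sub>1 \<in> circle" "\<alpha>\<^sub>2 \<in> circle" "0 < \<epsilon>" "\<epsilon> < 1" "\<epsilon> \<le> \<beta> + 1"
  shows "bergman_norm_sq \<beta> (peak (\<beta> + 2 - 2 * \<epsilon>) \<alpha>\<^sub>1 \<alpha>\<^sub>2) < \<infinity>"
proof -
  define F where "F \<alpha> z = ennreal (cmod (\<alpha> - z) powr (- (\<beta> + 2 - 2 * \<epsilon>)) *
      (1 - (cmod z)\<^sup>2) powr \<beta>) * indicator (ball 0 1) z" for \<alpha> z
  have [measurable]: "F \<alpha> \<in> borel_measurable borel" for \<alpha>
  proof -
    have [measurable]: "ball 0 1 \<in> sets (borel :: complex measure)"
      by simp
    show ?thesis
      unfolding F_def[abs_def] by measurable
  qed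
  have "bergman_norm_sq \<beta> (peak (\<beta> + 2 - 2 * \<epsilon>) \<alpha>\<^sub>1 \<alpha>\<^sub>2) = (\<integral>\<^sup>+z. F \<alpha>\<^sub>1 (fst z) * F \<alpha>\<^sub>2 (snd z) \<partial>dV)"
    unfolding bergman_norm_sq_def cmod_peak[OF assms(1,2)]
    by (intro nn_integral_cong)
       (auto simp: F_def bidisc_def indicator_def ennreal_mult[symmetric] mult_ac)
  also have "\<dots> = (\<integral>\<^sup>+z. F \<alpha>\<^sub>1 z \<partial>dA) * (\<integral>\<^sup>+z. F \<alpha>\<^sub>2 z \<partial>dA)"
    unfolding dV_def by (rule dA.nn_integral_pair_mult) auto
  also have "\<dots> < \<infinity>"
    using nn_integral_disc_powr_finite[OF assms(1,3-5)] nn_integral_disc_powr_finite[OF assms(2,3-5)]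
    by (simp add: F_def[abs_def] ennreal_mult_less_top)
  finally show ?thesis .
qed

lemma hardy_norm_sq_peak_finite:
  assumes "\<alpha>\<^sub>1 \<in> circle" "\<alpha>\<^sub>2 \<in> circle" "0 < G" "G < 1"
  shows "hardy_norm_sq (peak G \<alpha>\<^sub>1 \<alpha>\<^sub>2) < \<infinity>"
proof -
  define F where "F \<alpha> r s = ennreal (cmod (\<alpha> - complex_of_real r * cis s) powr (- G)) * indicator {0..2*pi} s"
    for \<alpha> r s
  have cis_meas [measurable]: "cis \<in> borel_measurable borel"
    by (intro borel_measurable_continuous_onI continuous_intros)
  have [measurable]: "F \<alpha> r \<in> borel_measurable borel" for \<alpha> r
    unfolding F_def[abs_def] by measurable
  obtain C1 C2 where C: "C1 < \<infinity>" "C2 < \<infinity>"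
    "\<And>r. r \<in> {0<..<1} \<Longrightarrow> (\<integral>\<^sup>+s. F \<alpha>\<^sub>1 r s \<partial>lborel) \<le> C1"
    "\<And>r. r \<in> {0<..<1} \<Longrightarrow> (\<integral>\<^sup>+s. F \<alpha>\<^sub>2 r s \<partial>lborel) \<le> C2"
    using nn_integral_circle_powr_bounded[OF assms(1,3,4)] nn_integral_circle_powr_bounded[OF assms(2-4)]
    unfolding F_def by blast
  have "hardy_norm_sq (peak G \<alpha>\<^sub>1 \<alpha>\<^sub>2) \<le> C1 * C2"
    unfolding hardy_norm_sq_def
  proof (rule SUP_least)
    fix r :: real assume r: "r \<in> {0<..<1}"
    have "(\<integral>\<^sup>+x\<in>{0..2*pi} \<times> {0..2*pi}. (case x of (s, t) \<Rightarrow>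
        ennreal ((cmod (peak G \<alpha>\<^sub>1 \<alpha>\<^sub>2 (of_real r * cis s, of_real r * cis t)))\<^sup>2 / (2 * pi)\<^sup>2)) \<partial>lborel)
      \<le> (\<integral>\<^sup>+x. F \<alpha>\<^sub>1 r (fst x) * F \<alpha>\<^sub>2 r (snd x) \<partial>lborel)"
    proof (intro nn_integral_mono)
      fix x :: "real \<times> real"
      have "1 \<le> (2 * pi)\<^sup>2"
        using pi_gt3 by (intro one_le_power) auto
      then have *: "a / (4 * pi\<^sup>2) \<le> a" if "a \<ge> 0" for a
        using that divide_left_mono[of 1 "(2 * pi)\<^sup>2" a] by (simp add: power_mult_distrib)
      show "(case x of (s, t) \<Rightarrow>
        ennreal ((cmod (peak G \<alpha>\<^sub>1 \<alpha>\<^sub>2 (of_real r * cis s, of_real r * cis t)))\<^sup>2 / (2 * pi)\<^sup>2)) *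
          indicator ({0..2*pi} \<times> {0..2*pi}) x \<le> F \<alpha>\<^sub>1 r (fst x) * F \<alpha>\<^sub>2 r (snd x)"
        unfolding cmod_peak[OF assms(1,2)] F_def
        by (cases x) (auto simp: indicator_def ennreal_mult[symmetric] power_mult_distrib intro!: ennreal_leI *)
    qed
    also have "\<dots> = (\<integral>\<^sup>+s. F \<alpha>\<^sub>1 r s \<partial>lborel) * (\<integral>\<^sup>+s. F \<alpha>\<^sub>2 r s \<partial>lborel)"
      unfolding lborel_prod[symmetric] by (rule lborel.nn_integral_pair_mult) auto
    also have "\<dots> \<le> C1 * C2"
      using C r by (intro mult_mono) auto
    finally show "(\<integral>\<^sup>+x\<in>{0..2*pi} \<times> {0..2*pi}. (case x of (s, t) \<Rightarrow>
        ennreal ((cmod (peak G \<alpha>\<^sub>1 \<alpha>\<^sub>2 (of_real r * cis s, of_real r * cis t)))\<^sup>2 / (2 * pi)\<^sup>2)) \<partial>lborel)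
      \<le> C1 * C2" .
  qed
  also have "\<dots> < \<infinity>"
    using C by (simp add: ennreal_mult_less_top)
  finally show ?thesis .
qed

lemma peak_in_A2:
  assumes "\<alpha>\<^sub>1 \<in> circle" "\<alpha>\<^sub>2 \<in> circle" "\<beta> \<ge> -1"
  shows "\<exists>G>\<beta> + 3/2. peak G \<alpha>\<^sub>1 \<alpha>\<^sub>2 \<in> A2 \<beta>"
proof (cases "\<beta> = -1")
  case True
  \<comment> \<open>For \<open>\<beta> = -1\<close> any exponent strictly between 1/2 and 1
    serves.\<close>
  have "peak (3/4) \<alpha>\<^sub>1 \<alpha>\<^sub>2 \<in> A2 \<beta>"
    using assms True by (simp add: A2_def A2_norm_sq_def holomorphic2_peak
      hardy_norm_sq_peak_finite[unfolded infinity_ennreal_def])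
  then show ?thesis
    using True by (intro exI[of _ "3/4"]) auto
next
  case False
  \<comment> \<open>With \<open>G = \<beta> + 2 - 2 * \<epsilon>\<close>, the condition
    \<open>G > \<beta> + 3/2\<close> amounts to \<open>\<epsilon> < 1/4\<close>. The second argument
    of \<open>min\<close> secures \<open>\<epsilon> \<le> \<beta> + 1\<close>, required for
    finiteness.\<close>
  define \<epsilon> where "\<epsilon> = min (1/8) (\<beta> + 1)"
  have e: "0 < \<epsilon>" "\<epsilon> < 1/4" "\<epsilon> \<le> \<beta> + 1"
    using False assms by (auto simp: \<epsilon>_def min_def)
  have "peak (\<beta> + 2 - 2 * \<epsilon>) \<alpha>\<^sub>1 \<alpha>\<^sub>2 \<in> A2 \<beta>"
    using bergman_norm_sq_peak_finite[OF assms(1,2), of \<epsilon> \<beta>] e assms False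
    by (simp add: A2_def A2_norm_sq_def holomorphic2_peak)
  then show ?thesis
    using e by (intro exI[of _ "\<beta> + 2 - 2 * \<epsilon>"]) auto
qed

section \<open>Lower bounds near a curve\<close>

text \<open>By disjointness, the step function with value \<open>v\<close> on every
  \<open>B k\<close> stays below \<open>F\<close>. The comparison uses only monotonicity of the
  integral, so \<open>F\<close> can be an arbitrary function.\<close>

lemma nn_integral_ge_disjoint:
  assumes [measurable]: "\<And>k. k < N \<Longrightarrow> B k \<in> sets M"
    and "disjoint_family_on B {..<N}"
    and m: "\<And>k. k < N \<Longrightarrow> m \<le> emeasure M (B k)"
    and F: "\<And>k x. k < N \<Longrightarrow> x \<in> B k \<Longrightarrow> v \<le> F x"
  shows "of_nat N * m * v \<le> (\<integral>\<^sup>+x. F x \<partial>M)"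
proof -
  have "of_nat N * m * v = (\<Sum>k<N. v * m)"
    by (simp add: mult_ac)
  also have "\<dots> \<le> (\<Sum>k<N. v * emeasure M (B k))"
    by (intro sum_mono mult_left_mono m) auto
  also have "\<dots> = (\<integral>\<^sup>+x. (\<Sum>k<N. v * indicator (B k) x) \<partial>M)"
    by (subst nn_integral_sum) (auto simp: nn_integral_cmult_indicator)
  also have "\<dots> \<le> (\<integral>\<^sup>+x. F x \<partial>M)"
  proof (rule nn_integral_mono)
    fix x
    show "(\<Sum>k<N. v * indicator (B k) x) \<le> F x"
    proof (cases "\<exists>k<N. x \<in> B k")
      case True
      then obtain k where k: "k < N" "x \<in> B k"
        by blast
      have "(\<Sum>j<N. v * indicator (B j) x) = (\<Sum>j\<in>{k}. v * indicator (B j) x)"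
        using k assms(2)
        by (intro sum.mono_neutral_right) (auto simp: disjoint_family_on_def indicator_def)
      then show ?thesis
        using F[OF k] k by simp
    next
      case False
      then have "(\<Sum>k<N. v * indicator (B k) x) = 0"
        by (intro sum.neutral) auto
      then show ?thesis
        by (simp only: zero_le)
    qed
  qed
  finally show ?thesis .
qed

lemma emeasure_dA_ball: "\<rho> \<ge> 0 \<Longrightarrow> emeasure dA (ball c \<rho>) = ennreal (\<rho>\<^sup>2)"
  by (simp add: emeasure_dA emeasure_ball unit_ball_vol_2 ennreal_mult[symmetric])

text \<open>Take \<open>N\<close> boxes, each a product of two discs of radius
  \<open>\<delta> / 16\<close> centred at \<open>1 - 2 * \<delta>\<close> times a point of the
  curve, with parameters \<delta> apart. On a box both weights are comparable to
  \<open>\<delta> powr \<beta>\<close>, and its volume is \<open>(\<delta> / 16) ^ 4\<close>. Since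
  \<open>N * \<delta> = l\<close>, summing gives \<open>l * \<delta> powr (3 + 2 * \<beta>)\<close>
  up to a constant. The boxes are separated by their first coordinates alone, so \<gamma> may be any
  function into the circle.\<close>

lemma bergman_norm_sq_ge:
  fixes \<gamma> :: "real \<Rightarrow> complex"
  assumes l: "0 < l" "l \<le> 1" and N: "0 < N" and \<delta>: "\<delta> = l / real N" "\<delta> \<le> 1/8"
    and \<gamma>: "\<And>s. s \<in> {a..a + l} \<Longrightarrow> \<gamma> s \<in> circle"
    and "0 \<le> V"
    and h: "\<And>s z. s \<in> {a..a + l} \<Longrightarrow> z \<in> bidisc \<Longrightarrow> cmod (fst z - cis s) \<le> 3 * \<delta> \<Longrightarrow>
      cmod (snd z - \<gamma> s) \<le> 3 * \<delta> \<Longrightarrow> V \<le> (cmod (h z))\<^sup>2"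
  shows "ennreal ((min 1 (6 powr \<beta>))\<^sup>2 / 16 ^ 4 * l * \<delta> powr (3 + 2 * \<beta>) * V) \<le> bergman_norm_sq \<beta> h"
proof -
  \<comment> \<open>On the boxes \<open>1 - (cmod z)\<^sup>2\<close> lies between \<delta> and
    \<open>6 * \<delta>\<close>. For \<open>\<beta> \<ge> 0\<close> the lower end bounds the weight
    from below, for negative \<beta> the upper end does; the minimum covers both signs.\<close>
  define \<kappa> where "\<kappa> = min 1 (6 powr \<beta>)"
  have \<kappa>: "\<kappa> > 0"
    by (simp add: \<kappa>_def)
  have \<delta>0: "\<delta> > 0"
    using l N \<delta> by simp
  define s where "s k = a + real k * \<delta>" for k
  have s: "s k \<in> {a..a + l}" if "k < N" for k
  proof -
    have "real k * \<delta> \<le> real N * \<delta>"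
      using that \<delta>0 by (intro mult_right_mono) auto
    also have "\<dots> = l"
      using \<delta>(1) N by simp
    finally show ?thesis
      using \<delta>0 by (simp add: s_def)
  qed
  define B where "B k = ball (of_real (1 - 2 * \<delta>) * cis (s k)) (\<delta> / 16) \<times>
      ball (of_real (1 - 2 * \<delta>) * \<gamma> (s k)) (\<delta> / 16)" for k
  have near: "cmod z \<le> 1 - \<delta>" "1 - 3 * \<delta> \<le> cmod z" "cmod (z - w) \<le> 3 * \<delta>"
    if "w \<in> circle" "z \<in> ball (of_real (1 - 2 * \<delta>) * w) (\<delta> / 16)" for z w
  proof -
    have n: "cmod (of_real (1 - 2 * \<delta>) * w) = 1 - 2 * \<delta>"
      using that(1) \<delta>(2) by (simp only: norm_mult norm_of_real) simp
    have d: "cmod (z - of_real (1 - 2 * \<delta>) * w) < \<delta> / 16"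
      using that(2) by (simp add: dist_norm norm_minus_commute)
    have "of_real (1 - 2 * \<delta>) * w - w = of_real (- 2 * \<delta>) * w"
      by (simp add: algebra_simps)
    then have e: "cmod (of_real (1 - 2 * \<delta>) * w - w) = 2 * \<delta>"
      using that(1) \<delta>0 by (simp only: norm_mult norm_of_real) simp
    show "cmod z \<le> 1 - \<delta>" "1 - 3 * \<delta> \<le> cmod z"
      using n d \<delta>0 norm_triangle_ineq2[of z "of_real (1 - 2 * \<delta>) * w"]
        norm_triangle_ineq3[of z "of_real (1 - 2 * \<delta>) * w"] by linarith+
    show "cmod (z - w) \<le> 3 * \<delta>"
      using d e \<delta>0 norm_triangle_ineq[of "z - of_real (1 - 2 * \<delta>) * w" "of_real (1 - 2 * \<delta>) * w - w"]
      by simp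
  qed
  have weight: "\<kappa> * \<delta> powr \<beta> \<le> (1 - (cmod z)\<^sup>2) powr \<beta>"
    if "cmod z \<le> 1 - \<delta>" "1 - 3 * \<delta> \<le> cmod z" for z :: complex
  proof -
    have sq: "1 - (cmod z)\<^sup>2 = (1 - cmod z) * (1 + cmod z)"
      by (simp add: power2_eq_square algebra_simps)
    have "\<delta> * 1 \<le> (1 - cmod z) * (1 + cmod z)"
      using that \<delta>0 by (intro mult_mono) auto
    then have lo: "\<delta> \<le> 1 - (cmod z)\<^sup>2"
      by (simp add: sq)
    have "(1 - cmod z) * (1 + cmod z) \<le> (3 * \<delta>) * 2"
      using that \<delta>0 \<delta> by (intro mult_mono) auto
    then have up: "1 - (cmod z)\<^sup>2 \<le> 6 * \<delta>"
      by (simp add: sq)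
    show ?thesis
    proof (cases "\<beta> \<ge> 0")
      case True
      have "\<kappa> * \<delta> powr \<beta> \<le> 1 * \<delta> powr \<beta>"
        by (intro mult_right_mono) (auto simp: \<kappa>_def)
      also have "\<dots> \<le> (1 - (cmod z)\<^sup>2) powr \<beta>"
        using lo \<delta>0 True by (simp add: powr_mono2)
      finally show ?thesis .
    next
      case False
      have "\<kappa> * \<delta> powr \<beta> \<le> 6 powr \<beta> * \<delta> powr \<beta>"
        by (intro mult_right_mono) (auto simp: \<kappa>_def)
      also have "\<dots> = (6 * \<delta>) powr \<beta>"
        using \<delta>0 by (simp add: powr_mult)
      also have "\<dots> \<le> (1 - (cmod z)\<^sup>2) powr \<beta>"
        using lo up \<delta>0 False by (intro powr_mono2') auto
      finally show ?thesis .
    qed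
  qed
  define v where "v = V * (\<kappa> * \<delta> powr \<beta>) * (\<kappa> * \<delta> powr \<beta>)"
  define F where "F z = ennreal ((cmod (h z))\<^sup>2 * (1 - (cmod (fst z))\<^sup>2) powr \<beta> *
      (1 - (cmod (snd z))\<^sup>2) powr \<beta>) * indicator bidisc z" for z
  have "of_nat N * ennreal ((\<delta> / 16) ^ 4) * ennreal v \<le> (\<integral>\<^sup>+z. F z \<partial>dV)"
  proof (rule nn_integral_ge_disjoint[where B = B])
    fix k assume k: "k < N"
    show "B k \<in> sets dV"
      unfolding B_def dV_def by (intro pair_measureI) auto
    have "emeasure dV (B k) = ennreal ((\<delta> / 16)\<^sup>2) * ennreal ((\<delta> / 16)\<^sup>2)"
      unfolding B_def dV_def using \<delta>0
      by (subst dA.emeasure_pair_measure_Times) (auto simp: emeasure_dA_ball)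
    also have "\<dots> = ennreal ((\<delta> / 16) ^ 4)"
      by (simp add: ennreal_mult[symmetric] power2_eq_square power4_eq_xxxx mult.assoc)
    finally show "ennreal ((\<delta> / 16) ^ 4) \<le> emeasure dV (B k)"
      by simp
    fix z assume z: "z \<in> B k"
    have z1: "fst z \<in> ball (of_real (1 - 2 * \<delta>) * cis (s k)) (\<delta> / 16)"
      and z2: "snd z \<in> ball (of_real (1 - 2 * \<delta>) * \<gamma> (s k)) (\<delta> / 16)"
      using z by (auto simp: B_def)
    have c: "cis (s k) \<in> circle"
      by simp
    note n1 = near[OF c z1] and n2 = near[OF \<gamma>[OF s[OF k]] z2]
    have zb: "z \<in> bidisc"
      using n1(1) n2(1) \<delta>0 by (cases z) (auto simp: bidisc_def)
    have "v \<le> (cmod (h z))\<^sup>2 * (1 - (cmod (fst z))\<^sup>2) powr \<beta> * (1 - (cmod (snd z))\<^sup>2) powr \<beta>"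
      unfolding v_def using h[OF s[OF k] zb n1(3) n2(3)] \<open>0 \<le> V\<close> \<kappa>
      by (intro mult_mono weight n1(1,2) n2(1,2)) auto
    then show "ennreal v \<le> F z"
      unfolding F_def using zb by (simp add: ennreal_leI)
  next
    show "disjoint_family_on B {..<N}"
      unfolding disjoint_family_on_def
    proof (intro ballI impI)
      fix j k assume jk: "j \<in> {..<N}" "k \<in> {..<N}" "j \<noteq> k"
      have "1 * \<delta> \<le> \<bar>real j - real k\<bar> * \<delta>"
        using jk \<delta>0 by (intro mult_right_mono) auto
      also have "\<dots> = \<bar>s j - s k\<bar>"
      proof -
        have "s j - s k = (real j - real k) * \<delta>"
          by (simp add: s_def algebra_simps)
        then show ?thesis
          using \<delta>0 by (simp add: abs_mult)
      qed
      finally have sep: "\<delta> \<le> \<bar>s j - s k\<bar>"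
        by simp
      have "\<bar>s j - s k\<bar> \<le> pi"
        using s[of j] s[of k] jk l pi_gt3 by auto
      then have "\<bar>s j - s k\<bar> / 4 \<le> cmod (cis (s j) - cis (s k))"
        by (rule cmod_cis_diff_ge)
      with sep have c: "\<delta> / 4 \<le> cmod (cis (s j) - cis (s k))"
        by simp
      \<comment> \<open>The sum of the two radii is \<open>\<delta> / 8\<close>. The centres are
        further apart, because the chord is at least \<open>\<delta> / 4\<close> and the factor
        \<open>1 - 2 * \<delta>\<close> is at least 3/4.\<close>
      have "\<delta> / 8 \<le> 3 / 4 * (\<delta> / 4)"
        using \<delta>0 by simp
      also have "\<dots> \<le> (1 - 2 * \<delta>) * cmod (cis (s j) - cis (s k))"
        using c \<delta>(2) \<delta>0 by (intro mult_mono) auto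
      also have "\<dots> = cmod (of_real (1 - 2 * \<delta>) * (cis (s j) - cis (s k)))"
        using \<delta>(2) by (simp only: norm_mult norm_of_real)
      finally have "\<delta> / 16 + \<delta> / 16 \<le> dist (of_real (1 - 2 * \<delta>) * cis (s j)) (of_real (1 - 2 * \<delta>) * cis (s k))"
        by (simp add: dist_norm right_diff_distrib)
      then have "ball (of_real (1 - 2 * \<delta>) * cis (s j)) (\<delta> / 16) \<inter>
          ball (of_real (1 - 2 * \<delta>) * cis (s k)) (\<delta> / 16) = {}"
        by (rule disjoint_ballI)
      then show "B j \<inter> B k = {}"
        unfolding B_def by blast
    qed
  qed
  also have "of_nat N * ennreal ((\<delta> / 16) ^ 4) * ennreal v = ennreal (real N * (\<delta> / 16) ^ 4 * v)"
    using \<delta>0 \<open>0 \<le> V\<close> \<kappa> by (simp add: v_def ennreal_mult ennreal_of_nat_eq_real_of_nat)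
  also have "real N * (\<delta> / 16) ^ 4 * v = \<kappa>\<^sup>2 / 16 ^ 4 * l * \<delta> powr (3 + 2 * \<beta>) * V"
  proof -
    have "\<delta> powr (3 + 2 * \<beta>) = \<delta> powr (real 3) * \<delta> powr (\<beta> + \<beta>)"
      by (subst powr_add[symmetric]) simp
    also have "\<dots> = \<delta> ^ 3 * (\<delta> powr \<beta> * \<delta> powr \<beta>)"
      using \<delta>0 by (simp only: powr_realpow powr_add)
    finally have 1: "\<delta> powr (3 + 2 * \<beta>) = \<delta> ^ 3 * (\<delta> powr \<beta> * \<delta> powr \<beta>)" .
    have 2: "l = real N * \<delta>"
      using \<delta> N by simp
    show ?thesis
      unfolding 1 v_def by (subst 2) (simp add: power2_eq_square power3_eq_cube power4_eq_xxxx)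
  qed
  finally show ?thesis
    by (simp add: F_def bergman_norm_sq_def \<kappa>_def)
qed

text \<open>The norm is a supremum over radii, so the single radius \<open>1 - \<delta>\<close>
  gives a lower bound. On that torus, \<open>N\<close> disjoint parameter squares of side \<delta>
  lie close to the curve. Their total area is
  \<open>N * \<delta>\<^sup>2 = l * \<delta>\<close>.\<close>

lemma hardy_norm_sq_ge:
  fixes \<gamma> :: "real \<Rightarrow> complex"
  assumes a: "0 \<le> a" "a + l \<le> 2 * pi" and l: "0 < l" and N: "0 < N"
    and \<delta>: "\<delta> = l / real N" "\<delta> \<le> 1/8"
    and \<gamma>: "\<And>s. s \<in> {a..a + l} \<Longrightarrow> \<gamma> s \<in> circle"
    and "0 \<le> V"
    and h: "\<And>s z. s \<in> {a..a + l} \<Longrightarrow> z \<in> bidisc \<Longrightarrow> cmod (fst z - cis s) \<le> 3 * \<delta> \<Longrightarrow>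
      cmod (snd z - \<gamma> s) \<le> 3 * \<delta> \<Longrightarrow> V \<le> (cmod (h z))\<^sup>2"
  shows "ennreal (l * \<delta> * V / (2 * pi)\<^sup>2) \<le> hardy_norm_sq h"
proof -
  have \<delta>0: "\<delta> > 0"
    using l N \<delta> by simp
  have lN: "l = real N * \<delta>"
    using \<delta> N by simp
  define s where "s k = a + real k * \<delta>" for k
  have s: "a \<le> s k" "s k + \<delta> \<le> a + l" if "k < N" for k
  proof -
    have "(real k + 1) * \<delta> \<le> real N * \<delta>"
      using that \<delta>0 by (intro mult_right_mono) auto
    then show "s k + \<delta> \<le> a + l"
      unfolding s_def lN by (simp add: algebra_simps)
  qed (use \<delta>0 in \<open>simp add: s_def\<close>)
  have "\<exists>t. 0 \<le> t \<and> t < 2 * pi \<and> \<gamma> (s k) = cis t" if "k < N" for k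
    using circle_eq_cis[OF \<gamma>[of "s k"]] s[OF that] \<delta>0 by (metis add.commute add_le_cancel_right
      atLeastAtMost_iff less_eq_real_def order_trans le_add_same_cancel1)
  then obtain t where t: "0 \<le> t k" "t k < 2 * pi" "\<gamma> (s k) = cis (t k)" if "k < N" for k
    by metis
  \<comment> \<open>The interval of length \<delta> must contain \<open>t k\<close> and remain
    inside \<open>{0..2*pi}\<close>. It is placed to the left of \<open>t k\<close> when there is no
    room on the right.\<close>
  define q where "q k = (if t k + \<delta> \<le> 2 * pi then t k else t k - \<delta>)" for k
  \<comment> \<open>Half-open intervals in the first parameter keep neighbouring squares disjoint,
    whatever the second parameter does.\<close>
  define B where "B k = {s k..<s k + \<delta>} \<times> {q k..q k + \<delta>}" for k
  define r where "r = 1 - \<delta>"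
  have r: "r \<in> {0<..<1}"
    unfolding r_def using \<delta>(2) \<delta>0 by (simp only: greaterThanLessThan_iff) simp
  define F where "F x = (case x of (s, t) \<Rightarrow>
      ennreal ((cmod (h (of_real r * cis s, of_real r * cis t)))\<^sup>2 / (2 * pi)\<^sup>2)) *
      indicator ({0..2*pi} \<times> {0..2*pi}) x" for x :: "real \<times> real"
  have near: "cmod (of_real r * cis x - cis y) \<le> 3 * \<delta>" if "\<bar>x - y\<bar> \<le> \<delta>" for x y
  proof -
    have "of_real r * cis x - cis x = of_real (- \<delta>) * cis x"
      by (simp add: r_def algebra_simps)
    then have "cmod (of_real r * cis x - cis x) = \<delta>"
      using \<delta>0 by (simp only: norm_mult norm_of_real) simp
    then show ?thesis
      using norm_triangle_ineq[of "of_real r * cis x - cis x" "cis x - cis y"]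
        cmod_cis_diff_le[of x y] that \<delta>0 by simp
  qed
  have "of_nat N * ennreal (\<delta>\<^sup>2) * ennreal (V / (2 * pi)\<^sup>2) \<le> (\<integral>\<^sup>+x. F x \<partial>lborel)"
  proof (rule nn_integral_ge_disjoint[where B = B])
    fix k assume k: "k < N"
    show "B k \<in> sets lborel"
      unfolding B_def lborel_prod[symmetric] by (intro pair_measureI) auto
    have "emeasure lborel (B k) = ennreal \<delta> * ennreal \<delta>"
      unfolding B_def lborel_prod[symmetric] using \<delta>0
      by (subst lborel.emeasure_pair_measure_Times) auto
    then show "ennreal (\<delta>\<^sup>2) \<le> emeasure lborel (B k)"
      using \<delta>0 by (simp add: ennreal_mult power2_eq_square)
    fix x assume x: "x \<in> B k"
    obtain x1 x2 where xx: "x = (x1, x2)"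
      by (cases x)
    have x1: "s k \<le> x1" "x1 \<le> s k + \<delta>" and x2: "q k \<le> x2" "x2 \<le> q k + \<delta>"
      using x by (auto simp: B_def xx)
    have q: "0 \<le> q k" "q k + \<delta> \<le> 2 * pi" "q k \<le> t k" "t k \<le> q k + \<delta>"
      using t(1,2)[OF k] \<delta> \<delta>0 pi_gt3 by (auto simp: q_def)
    have xq: "x \<in> {0..2*pi} \<times> {0..2*pi}"
      using x1 x2 q s[OF k] a by (auto simp: xx)
    have "V \<le> (cmod (h (of_real r * cis x1, of_real r * cis x2)))\<^sup>2"
    proof (rule h[of "s k"])
      show "s k \<in> {a..a + l}"
        using s[OF k] \<delta>0 by auto
      show "(of_real r * cis x1, of_real r * cis x2) \<in> bidisc"
        using r by (simp add: bidisc_def norm_mult)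
      show "cmod (fst (of_real r * cis x1, of_real r * cis x2) - cis (s k)) \<le> 3 * \<delta>"
        using near[of x1 "s k"] x1 by simp
      show "cmod (snd (of_real r * cis x1, of_real r * cis x2) - \<gamma> (s k)) \<le> 3 * \<delta>"
        using near[of x2 "t k"] x2 q t(3)[OF k] by (simp add: abs_le_iff)
    qed
    then show "ennreal (V / (2 * pi)\<^sup>2) \<le> F x"
      using xq unfolding F_def xx by (simp add: ennreal_leI divide_right_mono)
  next
    show "disjoint_family_on B {..<N}"
      unfolding disjoint_family_on_def
    proof (intro ballI impI)
      have less: "s j + \<delta> \<le> s k" if "j < k" for j k
      proof -
        have "(real j + 1) * \<delta> \<le> real k * \<delta>"
          using that \<delta>0 by (intro mult_right_mono) auto
        then show ?thesis
          by (simp add: s_def algebra_simps)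
      qed
      fix j k assume "j \<in> {..<N}" "k \<in> {..<N}" "j \<noteq> k"
      then consider "s j + \<delta> \<le> s k" | "s k + \<delta> \<le> s j"
        using less[of j k] less[of k j] by linarith
      then show "B j \<inter> B k = {}"
        by cases (auto simp: B_def)
    qed
  qed
  also have "\<dots> \<le> hardy_norm_sq h"
    unfolding hardy_norm_sq_def F_def using r by (intro SUP_upper2[of r]) auto
  also have "of_nat N * ennreal (\<delta>\<^sup>2) * ennreal (V / (2 * pi)\<^sup>2) =
      ennreal (real N * \<delta>\<^sup>2 * (V / (2 * pi)\<^sup>2))"
  proof -
    have "of_nat N * ennreal x * ennreal y = ennreal (real N * x * y)" if "0 \<le> x" "0 \<le> y" for x y
      using that by (simp add: ennreal_mult ennreal_of_nat_eq_real_of_nat)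
    from this[of "\<delta>\<^sup>2" "V / (2 * pi)\<^sup>2"] show ?thesis
      using \<open>0 \<le> V\<close> by (simp only: zero_le_power2 zero_le_divide_iff) blast
  qed
  also have "real N * \<delta>\<^sup>2 * (V / (2 * pi)\<^sup>2) = l * \<delta> * V / (2 * pi)\<^sup>2"
    unfolding lN by (simp add: power2_eq_square)
  finally show ?thesis .
qed

text \<open>The Hardy and Bergman bounds take a common form, since
  \<open>\<delta> powr (3 + 2 * \<beta>)\<close> is \<delta> at \<open>\<beta> = -1\<close>. The
  constant is chosen before \<open>N\<close>, \<gamma>, \<open>h\<close>, \<open>V\<close> and
  \<delta>, so \<delta> can later tend to 0.\<close>

lemma A2_norm_sq_ge:
  assumes a: "0 \<le> a" "a + l \<le> 2 * pi" and l: "0 < l" "l \<le> 1"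
  shows "\<exists>c>0. \<forall>N \<gamma> h V \<delta>. 0 < N \<longrightarrow> \<delta> = l / real N \<longrightarrow> \<delta> \<le> 1/8 \<longrightarrow> 0 \<le> V \<longrightarrow>
    (\<forall>s\<in>{a..a + l}. \<gamma> s \<in> circle) \<longrightarrow>
    (\<forall>s\<in>{a..a + l}. \<forall>z\<in>bidisc. cmod (fst z - cis s) \<le> 3 * \<delta> \<longrightarrow>
      cmod (snd z - \<gamma> s) \<le> 3 * \<delta> \<longrightarrow> V \<le> (cmod (h z))\<^sup>2) \<longrightarrow>
    ennreal (c * \<delta> powr (3 + 2 * \<beta>) * V) \<le> A2_norm_sq \<beta> h"
proof (cases "\<beta> = -1")
  case True
  show ?thesis
  proof (intro exI[of _ "l / (2 * pi)\<^sup>2"] conjI allI impI)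
    fix N :: nat and \<gamma> :: "real \<Rightarrow> complex" and h V \<delta>
    assume N: "0 < N" and \<delta>: "\<delta> = l / real N" "\<delta> \<le> 1/8" and H: "0 \<le> V"
      "\<forall>s\<in>{a..a + l}. \<gamma> s \<in> circle"
      "\<forall>s\<in>{a..a + l}. \<forall>z\<in>bidisc. cmod (fst z - cis s) \<le> 3 * \<delta> \<longrightarrow>
        cmod (snd z - \<gamma> s) \<le> 3 * \<delta> \<longrightarrow> V \<le> (cmod (h z))\<^sup>2"
    have \<delta>0: "\<delta> > 0"
      using N l \<delta> by simp
    then have "l / (2 * pi)\<^sup>2 * \<delta> powr (3 + 2 * \<beta>) * V = l * \<delta> * V / (2 * pi)\<^sup>2"
      by (simp add: True)
    with hardy_norm_sq_ge[OF a l(1) N \<delta>, of \<gamma> V h] H show "ennreal (l / (2 * pi)\<^sup>2 * \<delta> powr (3 + 2 * \<beta>) * V) \<le> A2_norm_sq \<beta> h"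
      unfolding A2_norm_sq_def if_P[OF True] by (simp only:)
  qed (use l in simp)
next
  case False
  show ?thesis
  proof (intro exI[of _ "(min 1 (6 powr \<beta>))\<^sup>2 / 16 ^ 4 * l"] conjI allI impI)
    fix N :: nat and \<gamma> :: "real \<Rightarrow> complex" and h V \<delta>
    assume N: "0 < N" and \<delta>: "\<delta> = l / real N" "\<delta> \<le> 1/8" and H: "0 \<le> V"
      "\<forall>s\<in>{a..a + l}. \<gamma> s \<in> circle"
      "\<forall>s\<in>{a..a + l}. \<forall>z\<in>bidisc. cmod (fst z - cis s) \<le> 3 * \<delta> \<longrightarrow>
        cmod (snd z - \<gamma> s) \<le> 3 * \<delta> \<longrightarrow> V \<le> (cmod (h z))\<^sup>2"
    then show "ennreal ((min 1 (6 powr \<beta>))\<^sup>2 / 16 ^ 4 * l * \<delta> powr (3 + 2 * \<beta>) * V) \<le> A2_norm_sq \<beta> h"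
      unfolding A2_norm_sq_def if_not_P[OF False]
      by (intro bergman_norm_sq_ge[OF l N \<delta>, of a \<gamma>]) auto
  qed (use l in \<open>simp add: min_def\<close>)
qed

section \<open>Rational inner functions near a level curve\<close>

text \<open>This makes \<open>eval2_eq_sum\<close> available for every polynomial, in particular for
  a reflection, without computing its bidegree.\<close>

lemma bidegree_le_exists: "\<exists>n m. bidegree_le p n m"
proof -
  have "degree (coeff p j) \<le> (\<Sum>j\<le>degree p. degree (coeff p j))" for j
  proof (cases "j \<le> degree p")
    case True
    then show ?thesis
      by (intro member_le_sum) auto
  qed (simp add: coeff_eq_0)
  then show ?thesis
    unfolding bidegree_le_def by blast
qed

lemma continuous_on_eval2: "continuous_on S (eval2 p)"
proof -
  obtain n m where nm: "bidegree_le p n m"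
    using bidegree_le_exists by blast
  show ?thesis
    unfolding eval2_eq_sum[OF nm, abs_def] by (intro continuous_intros)
qed

text \<open>On the closed bidisc the monomial with exponents \<open>i\<close> and \<open>j\<close>
  is Lipschitz with constant \<open>i + j\<close>: change one variable at a time and bound the other
  factor by 1. Summing with the moduli of the coefficients gives the constant.\<close>

lemma eval2_lipschitz:
  "\<exists>L>0. \<forall>z w. cmod (fst z) \<le> 1 \<longrightarrow> cmod (snd z) \<le> 1 \<longrightarrow> cmod (fst w) \<le> 1 \<longrightarrow> cmod (snd w) \<le> 1 \<longrightarrow>
     cmod (eval2 p z - eval2 p w) \<le> L * (cmod (fst z - fst w) + cmod (snd z - snd w))"
proof -
  obtain n m where nm: "bidegree_le p n m"
    using bidegree_le_exists by blast
  define c where "c i j = coeff (coeff p j) i" for i j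
  define L where "L = (\<Sum>j\<le>m. \<Sum>i\<le>n. cmod (c i j) * (real i + real j))"
  have L0: "L \<ge> 0"
    unfolding L_def by (intro sum_nonneg) auto
  show ?thesis
  \<comment> \<open>The sum \<open>L\<close> can be 0, for instance when \<open>p\<close> is
    constant; adding 1 makes the constant positive.\<close>
  proof (intro exI[of _ "L + 1"] conjI allI impI)
    fix z w :: "complex \<times> complex"
    assume b: "cmod (fst z) \<le> 1" "cmod (snd z) \<le> 1" "cmod (fst w) \<le> 1" "cmod (snd w) \<le> 1"
    define d where "d = cmod (fst z - fst w) + cmod (snd z - snd w)"
    have mon: "cmod (fst z ^ i * snd z ^ j - fst w ^ i * snd w ^ j) \<le> (real i + real j) * d" for i j
    proof -
      have "fst z ^ i * snd z ^ j - fst w ^ i * snd w ^ j =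
          (fst z ^ i - fst w ^ i) * snd z ^ j + fst w ^ i * (snd z ^ j - snd w ^ j)"
        by (simp add: algebra_simps)
      also have "cmod \<dots> \<le> cmod (fst z ^ i - fst w ^ i) * cmod (snd z ^ j) +
          cmod (fst w ^ i) * cmod (snd z ^ j - snd w ^ j)"
        by (metis norm_mult norm_triangle_ineq)
      also have "\<dots> \<le> (real i * cmod (fst z - fst w)) * 1 + 1 * (real j * cmod (snd z - snd w))"
        using b by (intro add_mono mult_mono norm_power_diff) (auto simp: norm_power power_le_one)
      also have "\<dots> \<le> real i * d + real j * d"
        unfolding mult_1 mult_1_right d_def by (intro add_mono mult_left_mono) auto
      finally show ?thesis
        by (simp add: algebra_simps)
    qed
    have "eval2 p z - eval2 p w = (\<Sum>j\<le>m. \<Sum>i\<le>n. c i j * (fst z ^ i * snd z ^ j - fst w ^ i * snd w ^ j))"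
      unfolding eval2_eq_sum[OF nm] c_def by (simp add: sum_subtractf right_diff_distrib mult.assoc)
    also have "cmod \<dots> \<le> (\<Sum>j\<le>m. \<Sum>i\<le>n. cmod (c i j * (fst z ^ i * snd z ^ j - fst w ^ i * snd w ^ j)))"
      by (intro order_trans[OF norm_sum] sum_mono) auto
    also have "\<dots> \<le> (\<Sum>j\<le>m. \<Sum>i\<le>n. cmod (c i j) * ((real i + real j) * d))"
      unfolding norm_mult by (intro sum_mono mult_left_mono mon[unfolded norm_mult]) auto
    also have "\<dots> = L * d"
      by (simp add: L_def sum_distrib_right mult.assoc)
    also have "\<dots> \<le> (L + 1) * d"
      by (simp add: d_def mult_right_mono)
    finally show "cmod (eval2 p z - eval2 p w) \<le> (L + 1) * (cmod (fst z - fst w) + cmod (snd z - snd w))"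
      by (simp add: d_def)
  qed (use L0 in simp)
qed

text \<open>The radial points \<open>(1 - t) *\<^sub>R \<zeta>\<close> lie in the region of aperture
  1, as their distance to \<zeta> in the maximum norm is exactly \<open>t\<close>. This makes
  non-tangential limits unique.\<close>

lemma islimpt_nontangential_region:
  assumes "\<zeta> \<in> bitorus"
  shows "\<zeta> islimpt nontangential_region 1 \<zeta>"
  unfolding islimpt_approachable
proof (intro allI impI)
  fix e :: real assume e: "0 < e"
  define t where "t = min (1/2) (e / 4)"
  have t: "0 < t" "t \<le> 1/2" "2 * t < e"
    using e by (auto simp: t_def min_def)
  have n: "cmod (fst \<zeta>) = 1" "cmod (snd \<zeta>) = 1"
    using assms by (auto simp: bitorus_def)
  define z where "z = (1 - t) *\<^sub>R \<zeta>"
  have nz: "cmod (fst z) = 1 - t" "cmod (snd z) = 1 - t"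
    using n t by (auto simp: z_def)
  have d: "z - \<zeta> = (- t) *\<^sub>R \<zeta>"
    by (simp add: z_def algebra_simps)
  have dz: "cmod (fst z - fst \<zeta>) = t" "cmod (snd z - snd \<zeta>) = t"
    using n t arg_cong[OF d, of fst] arg_cong[OF d, of snd] by (auto simp del: scaleR_minus_left)
  have "norm (z - \<zeta>) \<le> norm (fst (z - \<zeta>)) + norm (snd (z - \<zeta>))"
    using norm_Pair_le[of "fst (z - \<zeta>)" "snd (z - \<zeta>)"] by (simp only: prod.collapse)
  then have "dist z \<zeta> \<le> t + t"
    using dz by (simp add: dist_norm)
  moreover have "z \<in> nontangential_region 1 \<zeta>"
    using nz dz t by (cases z) (auto simp: nontangential_region_def bidisc_def)
  moreover have "z \<noteq> \<zeta>"
    using dz t by auto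
  ultimately show "\<exists>z\<in>nontangential_region 1 \<zeta>. z \<noteq> \<zeta> \<and> dist z \<zeta> < e"
    using t by (intro bexI[of _ z]) auto
qed

text \<open>Where \<open>p\<close> does not vanish the quotient is continuous, so a non-tangential
  limit there is simply its value. Level sets are closures, so the equation still has to be carried
  to limit points.\<close>

lemma rif_eq_on_level_set:
  assumes "\<zeta> \<in> level_set (rif n m p) \<alpha>" "eval2 p \<zeta> \<noteq> 0"
  shows "rif n m p \<zeta> = \<alpha>"
proof -
  define U where "U = {z. eval2 p z \<noteq> 0}"
  define S where "S = {\<zeta>\<in>bitorus. has_nontangential_limit (rif n m p) \<alpha> \<zeta>}"
  \<comment> \<open>Clearing the denominator turns the equation into one between continuous
    functions on the whole space, so its solution set is closed.\<close>
  define Z where "Z = {z. eval2 (reflection n m p) z - \<alpha> * eval2 p z = 0}"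
  have "open U"
    unfolding U_def using continuous_on_eval2 by (intro open_Collect_neq) auto
  have "closed Z"
    unfolding Z_def by (intro closed_Collect_eq continuous_intros continuous_on_eval2)
  have "S \<inter> U \<subseteq> Z"
  proof
    fix \<xi> assume \<xi>: "\<xi> \<in> S \<inter> U"
    then have "isCont (eval2 p) \<xi>" "isCont (eval2 (reflection n m p)) \<xi>"
      using continuous_on_eval2[of UNIV] by (cases \<xi>; simp_all add: continuous_on_eq_continuous_at)+
    then have "isCont (rif n m p) \<xi>"
      unfolding rif_def[abs_def] using \<xi> by (intro continuous_intros) (auto simp: U_def)
    then have "(rif n m p \<longlongrightarrow> rif n m p \<xi>) (at \<xi> within nontangential_region 1 \<xi>)"
      unfolding isCont_def by (rule Lim_at_imp_Lim_at_within)
    moreover have "(rif n m p \<longlongrightarrow> \<alpha>) (at \<xi> within nontangential_region 1 \<xi>)"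
      using \<xi> by (simp add: S_def has_nontangential_limit_def)
    moreover have "\<not> trivial_limit (at \<xi> within nontangential_region 1 \<xi>)"
      using \<xi> islimpt_nontangential_region[of \<xi>] by (simp add: S_def trivial_limit_within)
    ultimately have "rif n m p \<xi> = \<alpha>"
      by (metis tendsto_unique)
    then show "\<xi> \<in> Z"
      using \<xi> by (auto simp: Z_def U_def rif_def field_simps)
  qed
  then have "closure (U \<inter> S) \<subseteq> Z"
    using \<open>closed Z\<close> by (intro closure_minimal) auto
  \<comment> \<open>As \<open>U\<close> is an open neighbourhood of \<zeta>, the approximating
    points of the level set can be taken inside \<open>U\<close>.\<close>
  moreover have "\<zeta> \<in> closure (U \<inter> S)"
    using open_Int_closure_subset[OF \<open>open U\<close>, of S] assms by (auto simp: level_set_def S_def U_def)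
  ultimately show ?thesis
    using assms(2) by (auto simp: Z_def rif_def field_simps)
qed

text \<open>With \<open>w = (\<zeta>, g \<zeta>)\<close> and \<open>q\<close> the reflection,
  \<open>q w = \<alpha> * p w\<close>. So \<open>\<alpha> - rif n m p z\<close> is a combination of
  the increments of \<open>p\<close> and \<open>q\<close> from \<open>w\<close> to \<open>z\<close>,
  divided by \<open>p z\<close>. The increments are of order \<delta> by the Lipschitz bounds. The
  minimum of \<open>cmod (eval2 p z)\<close> is taken over \<open>J \<times> circle\<close> instead
  of the graph of \<open>g\<close>, so that compactness does not rest on continuity of
  \<open>g\<close>.\<close>

lemma rif_near_level_curve:
  assumes J: "compact J" "J \<subseteq> circle" and \<alpha>: "\<alpha> \<in> circle"
    and p: "\<forall>\<zeta>\<in>J. \<forall>w\<in>circle. eval2 p (\<zeta>, w) \<noteq> 0"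
    and g: "\<forall>\<zeta>\<in>J. g \<zeta> \<in> circle" "\<forall>\<zeta>\<in>J. rif n m p (\<zeta>, g \<zeta>) = \<alpha>"
  shows "\<exists>L>0. \<exists>\<delta>\<^sub>0>0. \<forall>\<delta>. 0 < \<delta> \<longrightarrow> \<delta> < \<delta>\<^sub>0 \<longrightarrow> (\<forall>\<zeta>\<in>J. \<forall>z\<in>bidisc.
    cmod (fst z - \<zeta>) \<le> 3 * \<delta> \<longrightarrow> cmod (snd z - g \<zeta>) \<le> 3 * \<delta> \<longrightarrow> cmod (\<alpha> - rif n m p z) \<le> L * \<delta>)"
proof (cases "J = {}")
  case True
  then show ?thesis
    by (intro exI[of _ 1] conjI) auto
next
  case False
  obtain Lp where Lp: "Lp > 0" "\<And>z w. cmod (fst z) \<le> 1 \<Longrightarrow> cmod (snd z) \<le> 1 \<Longrightarrow> cmod (fst w) \<le> 1 \<Longrightarrow>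
      cmod (snd w) \<le> 1 \<Longrightarrow>
      cmod (eval2 p z - eval2 p w) \<le> Lp * (cmod (fst z - fst w) + cmod (snd z - snd w))"
    using eval2_lipschitz[of p] by blast
  define q where "q = reflection n m p"
  obtain Lq where Lq: "Lq > 0" "\<And>z w. cmod (fst z) \<le> 1 \<Longrightarrow> cmod (snd z) \<le> 1 \<Longrightarrow> cmod (fst w) \<le> 1 \<Longrightarrow>
      cmod (snd w) \<le> 1 \<Longrightarrow>
      cmod (eval2 q z - eval2 q w) \<le> Lq * (cmod (fst z - fst w) + cmod (snd z - snd w))"
    using eval2_lipschitz[of q] by blast
  have "compact (J \<times> circle)"
    using J by (intro compact_Times) auto
  moreover have "J \<times> circle \<noteq> {}"
    using False by (auto intro!: exI[of _ 1])
  moreover have "continuous_on (J \<times> circle) (\<lambda>z. cmod (eval2 p z))"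
    by (intro continuous_on_norm continuous_on_eval2)
  ultimately have "\<exists>x\<in>J \<times> circle. \<forall>y\<in>J \<times> circle. cmod (eval2 p x) \<le> cmod (eval2 p y)"
    by (rule continuous_attains_inf)
  then obtain x where x: "x \<in> J \<times> circle" "\<And>y. y \<in> J \<times> circle \<Longrightarrow> cmod (eval2 p x) \<le> cmod (eval2 p y)"
    by blast
  define c where "c = cmod (eval2 p x)"
  have c: "c > 0"
    using x(1) p by (auto simp: c_def)
  have main: "cmod (\<alpha> - rif n m p z) \<le> (Lp + Lq) * 6 / (c / 2) * \<delta>"
    if \<delta>: "0 < \<delta>" "\<delta> < c / (12 * Lp)" and \<zeta>: "\<zeta> \<in> J" and z: "z \<in> bidisc"
      and near: "cmod (fst z - \<zeta>) \<le> 3 * \<delta>" "cmod (snd z - g \<zeta>) \<le> 3 * \<delta>" for \<delta> \<zeta> z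
  proof -
    define w where "w = (\<zeta>, g \<zeta>)"
    have w: "w \<in> J \<times> circle" "cmod (fst w) \<le> 1" "cmod (snd w) \<le> 1"
      using \<zeta> bspec[OF g(1) \<zeta>] J(2) by (auto simp: w_def)
    have z1: "cmod (fst z) \<le> 1" "cmod (snd z) \<le> 1"
      using z by (auto simp: bidisc_def)
    have d: "cmod (fst z - fst w) + cmod (snd z - snd w) \<le> 6 * \<delta>"
      using near by (simp add: w_def)
    have dp: "cmod (eval2 p z - eval2 p w) \<le> Lp * (6 * \<delta>)"
      by (rule order_trans[OF Lp(2)[OF z1 w(2,3)] mult_left_mono[OF d]]) (use Lp(1) in simp)
    have dq: "cmod (eval2 q z - eval2 q w) \<le> Lq * (6 * \<delta>)"
      by (rule order_trans[OF Lq(2)[OF z1 w(2,3)] mult_left_mono[OF d]]) (use Lq(1) in simp)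
    \<comment> \<open>The threshold \<open>c / (12 * Lp)\<close> is chosen for this:
      \<open>p\<close> changes by at most half of its minimum \<open>c\<close>, so the denominator
      stays at least \<open>c / 2\<close>.\<close>
    have "Lp * (6 * \<delta>) \<le> c / 2"
      using \<delta> Lp(1) by (simp add: field_simps)
    moreover have "c \<le> cmod (eval2 p w)"
      using x(2)[OF w(1)] by (simp add: c_def)
    ultimately have pz: "c / 2 \<le> cmod (eval2 p z)"
      using dp norm_triangle_ineq2[of "eval2 p w" "eval2 p z"] by (simp add: norm_minus_commute)
    have "eval2 p w \<noteq> 0"
      using p w(1) by auto
    then have qw: "eval2 q w = \<alpha> * eval2 p w"
      using bspec[OF g(2) \<zeta>] by (simp add: rif_def q_def w_def field_simps)
    have "\<alpha> - rif n m p z = (\<alpha> * eval2 p z - eval2 q z) / eval2 p z"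
    proof -
      have "eval2 p z \<noteq> 0"
        using pz c by auto
      then show ?thesis
        by (simp add: rif_def q_def diff_divide_distrib)
    qed
    also have "\<dots> = (\<alpha> * (eval2 p z - eval2 p w) - (eval2 q z - eval2 q w)) / eval2 p z"
      by (simp add: qw algebra_simps)
    also have "cmod \<dots> \<le> (Lp * (6 * \<delta>) + Lq * (6 * \<delta>)) / (c / 2)"
      unfolding norm_divide
    proof (intro frac_le)
      show "cmod (\<alpha> * (eval2 p z - eval2 p w) - (eval2 q z - eval2 q w)) \<le> Lp * (6 * \<delta>) + Lq * (6 * \<delta>)"
        using norm_triangle_ineq4[of "\<alpha> * (eval2 p z - eval2 p w)" "eval2 q z - eval2 q w"] dp dq \<alpha>
        by (simp add: norm_mult)
    qed (use pz c Lp(1) Lq(1) \<delta>(1) in auto)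
    also have "\<dots> = (Lp + Lq) * 6 / (c / 2) * \<delta>"
      by (simp add: algebra_simps add_divide_distrib)
    finally show ?thesis .
  qed
  have "0 < (Lp + Lq) * 6 / (c / 2)" "0 < c / (12 * Lp)"
    using Lp(1) Lq(1) c by auto
  then show ?thesis
    using main by meson
qed

section \<open>Composition operators\<close>

lemma A2_norm_sq_zero_on_bidisc:
  assumes "\<And>z. z \<in> bidisc \<Longrightarrow> h z = 0"
  shows "A2_norm_sq \<beta> h = 0"
proof -
  have "h (of_real r * cis s, of_real r * cis t) = 0" if "r \<in> {0<..<1}" for r s t
    using that by (intro assms) (simp add: bidisc_def norm_mult)
  then have "hardy_norm_sq h = (SUP r\<in>{0<..<1::real}. 0)"
    unfolding hardy_norm_sq_def by (intro SUP_cong refl) (simp add: case_prod_unfold)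
  moreover have "bergman_norm_sq \<beta> h = (\<integral>\<^sup>+z. 0 \<partial>dV)"
    unfolding bergman_norm_sq_def using assms by (intro nn_integral_cong) (auto simp: indicator_def)
  ultimately show ?thesis
    by (simp add: A2_norm_sq_def)
qed

lemma holomorphic2_const_on_bidisc:
  assumes "\<And>z. z \<in> bidisc \<Longrightarrow> h z = c"
  shows "h holomorphic2_on bidisc"
  unfolding holomorphic2_on_def
proof
  fix z assume "z \<in> bidisc"
  then have "(h has_derivative (\<lambda>_. 0)) (at z within bidisc)"
    by (rule has_derivative_transform[OF _ _ has_derivative_const[of c]]) (use assms in auto)
  then show "\<exists>a b. (h has_derivative (\<lambda>k. a * fst k + b * snd k)) (at z within bidisc)"
    by (intro exI[of _ 0]) simp
qed

lemma holomorphic2_imp_continuous: "h holomorphic2_on S \<Longrightarrow> continuous_on S h"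
  unfolding holomorphic2_on_def continuous_on_eq_continuous_within
  by (meson has_derivative_continuous)

text \<open>Functions in \<open>A2\<close> are only determined on the bidisc.  Boundedness on the function that is
  \<open>0\<close> on the bidisc and \<open>1\<close> elsewhere therefore already excludes values of \<open>\<Phi>\<close> outside the bidisc,
  without an appeal to the maximum principle.\<close>

lemma composition_maps_bidisc:
  assumes "bounded_composition_operator \<beta> \<Phi>" "z \<in> bidisc"
  shows "\<Phi> z \<in> bidisc"
proof (rule ccontr)
  assume out: "\<Phi> z \<notin> bidisc"
  define u :: "complex \<times> complex \<Rightarrow> complex" where "u w = (if w \<in> bidisc then 0 else 1)" for w
  have u0: "A2_norm_sq \<beta> u = 0"
    by (rule A2_norm_sq_zero_on_bidisc) (simp add: u_def)
  then have u: "u \<in> A2 \<beta>"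
    by (simp add: A2_def holomorphic2_const_on_bidisc[of u 0] u_def)
  define v where "v = u \<circ> \<Phi>"
  have v: "v \<in> A2 \<beta>"
    using assms u by (simp add: bounded_composition_operator_def v_def)
  \<comment> \<open>A continuous function with values in \<open>{0, 1}\<close> on a connected set is
    constant. One point mapped outside the bidisc therefore forces all points to be mapped
    outside.\<close>
  have "connected bidisc"
    unfolding bidisc_def by (intro convex_connected convex_Times convex_ball)
  moreover have "continuous_on bidisc v"
    using v by (simp add: A2_def holomorphic2_imp_continuous)
  moreover have "finite (v ` bidisc)"
    by (rule finite_subset[of _ "{0, 1}"]) (auto simp: v_def u_def)
  ultimately have "v constant_on bidisc"
    by (rule continuous_finite_range_constant)
  moreover have "v z = 1"
    using out by (simp add: v_def u_def)
  ultimately have v1: "v w = 1" if "w \<in> bidisc" for w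
    using that assms(2) by (metis constant_on_def)
  obtain c where c: "c > 0"
    "\<And>N \<gamma> h V \<delta>. 0 < N \<Longrightarrow> \<delta> = 1 / real N \<Longrightarrow> \<delta> \<le> 1/8 \<Longrightarrow> 0 \<le> V \<Longrightarrow>
    (\<forall>s\<in>{0..0 + 1}. \<gamma> s \<in> circle) \<Longrightarrow>
    (\<forall>s\<in>{0..0 + 1}. \<forall>z\<in>bidisc. cmod (fst z - cis s) \<le> 3 * \<delta> \<longrightarrow>
      cmod (snd z - \<gamma> s) \<le> 3 * \<delta> \<longrightarrow> V \<le> (cmod (h z))\<^sup>2) \<Longrightarrow>
    ennreal (c * \<delta> powr (3 + 2 * \<beta>) * V) \<le> A2_norm_sq \<beta> h"
    using A2_norm_sq_ge[of 0 1 \<beta>] pi_gt3 by auto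
  \<comment> \<open>The general lower bound with \<open>N = 8\<close>, the constant curve 1 and
    \<open>V = 1\<close> shows that \<open>v\<close> has positive norm, while \<open>u\<close> has
    norm 0.\<close>
  have "ennreal (c * (1/8) powr (3 + 2 * \<beta>) * 1) \<le> A2_norm_sq \<beta> v"
    by (rule c(2)[of 8 _ _ "\<lambda>_. 1"]) (auto simp: v1)
  then have "0 < A2_norm_sq \<beta> v"
    using c(1) by (simp add: less_le_trans[rotated])
  moreover have "A2_norm_sq \<beta> v < \<infinity>"
    using v by (simp add: A2_def)
  ultimately have "0 < A2_norm \<beta> v"
    by (simp add: A2_norm_def enn2real_positive_iff)
  moreover obtain C where "A2_norm \<beta> v \<le> C * A2_norm \<beta> u"
    using assms(1) u unfolding bounded_composition_operator_def v_def by blast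
  ultimately show False
    by (simp add: A2_norm_def u0)
qed

text \<open>Subtracting a multiple of \<open>2 * pi\<close> moves the left endpoint into one period.
  Shortening the arc keeps it in that period and of length at most 1, as the lower bounds on the
  norm require.\<close>

lemma closed_arc_contains_normalized:
  assumes "closed_arc J"
  obtains a l where "0 \<le> a" "a + l \<le> 2 * pi" "0 < l" "l \<le> 1" "cis ` {a..a + l} \<subseteq> J"
proof -
  obtain c d where cd: "c < d" "J = cis ` {c..d}"
    using assms by (auto simp: closed_arc_def)
  define k where "k = \<lfloor>c / (2 * pi)\<rfloor>"
  define a where "a = c - 2 * pi * of_int k"
  have "of_int k \<le> c / (2 * pi)" "c / (2 * pi) < of_int k + 1"
    unfolding k_def by linarith+
  then have a: "0 \<le> a" "a < 2 * pi"
    by (simp_all add: a_def field_simps)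
  define l where "l = min 1 (min (d - c) (2 * pi - a))"
  have l: "0 < l" "l \<le> 1" "l \<le> d - c" "a + l \<le> 2 * pi"
    using a cd by (auto simp: l_def min_def)
  have "cis s \<in> J" if "s \<in> {a..a + l}" for s
  proof -
    have "cis s = cis (s + 2 * pi * of_int k)"
      using cis_multiple_2pi[of "of_int k"] by (simp add: cis_mult[symmetric])
    moreover have "s + 2 * pi * of_int k \<in> {c..d}"
      using that l by (auto simp: a_def)
    ultimately show ?thesis
      using cd(2) by blast
  qed
  then show ?thesis
    using that[of a l] a l by blast
qed

lemma level_set_parametrizationD:
  assumes "level_set_parametrization \<phi> \<alpha> \<tau> N g" "j \<in> {1..N}" "\<zeta> \<in> circle"
  shows "g j \<zeta> \<in> circle" "(\<zeta>, g j \<zeta>) \<in> level_set \<phi> \<alpha>"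
proof -
  have "g j ` circle \<subseteq> circle"
    using assms(1,2) by (simp add: level_set_parametrization_def)
  then show "g j \<zeta> \<in> circle"
    using assms(3) by (rule subsetD[OF _ imageI])
  obtain T where "level_set \<phi> \<alpha> = (\<Union>j\<in>{1..N}. {(\<zeta>, g j \<zeta>) |\<zeta>. \<zeta> \<in> circle}) \<union> T \<times> circle"
    using assms(1) unfolding level_set_parametrization_def by (elim conjE exE)
  then show "(\<zeta>, g j \<zeta>) \<in> level_set \<phi> \<alpha>"
    using assms(2,3) by auto
qed

text \<open>Within \<open>3 * \<delta>\<close> of the curve the squared modulus of the composition
  is at least \<open>(L * \<delta>) powr (- 2 * G)\<close>. The general lower bound for the norm
  then becomes a positive multiple of \<open>\<delta> powr (- e)\<close> with
  \<open>e = 2 * G - 3 - 2 * \<beta> > 0\<close>. This is unbounded along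
  \<open>\<delta> = l / N\<close>.\<close>

lemma peak_comp_norm_infinite:
  fixes \<gamma> :: "real \<Rightarrow> complex"
  assumes \<alpha>: "\<alpha>\<^sub>1 \<in> circle" "\<alpha>\<^sub>2 \<in> circle" and G: "\<beta> \<ge> -1" "G > \<beta> + 3/2"
    and a: "0 \<le> a" "a + l \<le> 2 * pi" "0 < l" "l \<le> 1"
    and \<gamma>: "\<And>s. s \<in> {a..a + l} \<Longrightarrow> \<gamma> s \<in> circle"
    and \<Phi>: "\<And>z. z \<in> bidisc \<Longrightarrow> \<Phi> z \<in> bidisc"
    and L: "L > 0" "\<delta>\<^sub>0 > 0"
    and near: "\<And>\<delta> s z. 0 < \<delta> \<Longrightarrow> \<delta> < \<delta>\<^sub>0 \<Longrightarrow> s \<in> {a..a + l} \<Longrightarrow> z \<in> bidisc \<Longrightarrow>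
      cmod (fst z - cis s) \<le> 3 * \<delta> \<Longrightarrow> cmod (snd z - \<gamma> s) \<le> 3 * \<delta> \<Longrightarrow>
      cmod (\<alpha>\<^sub>1 - fst (\<Phi> z)) \<le> L * \<delta> \<and> cmod (\<alpha>\<^sub>2 - snd (\<Phi> z)) \<le> L * \<delta>"
  shows "A2_norm_sq \<beta> (peak G \<alpha>\<^sub>1 \<alpha>\<^sub>2 \<circ> \<Phi>) = \<infinity>"
proof (rule ccontr)
  assume "A2_norm_sq \<beta> (peak G \<alpha>\<^sub>1 \<alpha>\<^sub>2 \<circ> \<Phi>) \<noteq> \<infinity>"
  then obtain R where R: "R \<ge> 0" "A2_norm_sq \<beta> (peak G \<alpha>\<^sub>1 \<alpha>\<^sub>2 \<circ> \<Phi>) = ennreal R"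
    by (cases "A2_norm_sq \<beta> (peak G \<alpha>\<^sub>1 \<alpha>\<^sub>2 \<circ> \<Phi>)" rule: ennreal_cases) auto
  obtain c where c: "c > 0"
    "\<And>N \<gamma> h V \<delta>. 0 < N \<Longrightarrow> \<delta> = l / real N \<Longrightarrow> \<delta> \<le> 1/8 \<Longrightarrow> 0 \<le> V \<Longrightarrow>
    (\<forall>s\<in>{a..a + l}. \<gamma> s \<in> circle) \<Longrightarrow>
    (\<forall>s\<in>{a..a + l}. \<forall>z\<in>bidisc. cmod (fst z - cis s) \<le> 3 * \<delta> \<longrightarrow>
      cmod (snd z - \<gamma> s) \<le> 3 * \<delta> \<longrightarrow> V \<le> (cmod (h z))\<^sup>2) \<Longrightarrow>
    ennreal (c * \<delta> powr (3 + 2 * \<beta>) * V) \<le> A2_norm_sq \<beta> h"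
    using A2_norm_sq_ge[OF a, of \<beta>] by blast
  define e where "e = 2 * G - 3 - 2 * \<beta>"
  have e: "e > 0"
    using G by (simp add: e_def)
  define K where "K = c * (L powr (- G) * L powr (- G))"
  have K: "K > 0"
    using c(1) L by (simp add: K_def)
  have lim: "(\<lambda>N. l / real N) \<longlonglongrightarrow> 0"
    by (rule lim_const_over_n)
  have "(\<lambda>N. (l / real N) powr e) \<longlonglongrightarrow> 0"
    by (rule tendsto_zero_powrI[OF lim tendsto_const]) (use a e in auto)
  \<comment> \<open>The denominator \<open>R + 1\<close> is positive even for \<open>R = 0\<close>.
    The threshold is the one that will contradict
    \<open>K * \<delta> powr (- e) \<le> R\<close>.\<close>
  then have "eventually (\<lambda>N. (l / real N) powr e < K / (R + 1)) sequentially"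
    using K R by (intro order_tendstoD(2)) auto
  moreover have "eventually (\<lambda>N. l / real N < min \<delta>\<^sub>0 (1/8)) sequentially"
    using L by (intro order_tendstoD(2)[OF lim]) auto
  ultimately have "eventually (\<lambda>N. 0 < N \<and> l / real N < min \<delta>\<^sub>0 (1/8) \<and>
      (l / real N) powr e < K / (R + 1)) sequentially"
    using eventually_gt_at_top[of 0] by eventually_elim auto
  then obtain N where N: "0 < N" "l / real N < min \<delta>\<^sub>0 (1/8)" "(l / real N) powr e < K / (R + 1)"
    using eventually_happens'[OF sequentially_bot] by blast
  define \<delta> where "\<delta> = l / real N"
  have \<delta>: "0 < \<delta>" "\<delta> < \<delta>\<^sub>0" "\<delta> \<le> 1/8" "\<delta> powr e < K / (R + 1)"
    using N a by (auto simp: \<delta>_def)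
  define V where "V = (L * \<delta>) powr (- G) * (L * \<delta>) powr (- G)"
  have "ennreal (c * \<delta> powr (3 + 2 * \<beta>) * V) \<le> A2_norm_sq \<beta> (peak G \<alpha>\<^sub>1 \<alpha>\<^sub>2 \<circ> \<Phi>)"
  proof (rule c(2)[OF N(1) \<delta>_def \<delta>(3), of _ \<gamma>])
    show "\<forall>s\<in>{a..a + l}. \<forall>z\<in>bidisc. cmod (fst z - cis s) \<le> 3 * \<delta> \<longrightarrow>
      cmod (snd z - \<gamma> s) \<le> 3 * \<delta> \<longrightarrow> V \<le> (cmod ((peak G \<alpha>\<^sub>1 \<alpha>\<^sub>2 \<circ> \<Phi>) z))\<^sup>2"
    proof (intro ballI impI)
      fix s z assume *: "s \<in> {a..a + l}" "z \<in> bidisc" "cmod (fst z - cis s) \<le> 3 * \<delta>"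
        "cmod (snd z - \<gamma> s) \<le> 3 * \<delta>"
      have le: "cmod (\<alpha>\<^sub>1 - fst (\<Phi> z)) \<le> L * \<delta>" "cmod (\<alpha>\<^sub>2 - snd (\<Phi> z)) \<le> L * \<delta>"
        using near[OF \<delta>(1,2) *] by auto
      have "cmod (fst (\<Phi> z)) < 1" "cmod (snd (\<Phi> z)) < 1"
        using \<Phi>[OF *(2)] by (auto simp: bidisc_def)
      \<comment> \<open>Positivity matters because 0 to a negative power is 0 by convention, which
        would destroy the lower bound. It holds because \<Phi> maps into the open bidisc.\<close>
      then have "0 < cmod (\<alpha>\<^sub>1 - fst (\<Phi> z))" "0 < cmod (\<alpha>\<^sub>2 - snd (\<Phi> z))"
        using \<alpha> by auto
      then have "V \<le> cmod (\<alpha>\<^sub>1 - fst (\<Phi> z)) powr (- G) * cmod (\<alpha>\<^sub>2 - snd (\<Phi> z)) powr (- G)"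
        unfolding V_def using le G by (intro mult_mono powr_mono2') auto
      then show "V \<le> (cmod ((peak G \<alpha>\<^sub>1 \<alpha>\<^sub>2 \<circ> \<Phi>) z))\<^sup>2"
        by (simp add: cmod_peak[OF \<alpha>])
    qed
  qed (use \<gamma> in \<open>auto simp: V_def\<close>)
  then have "c * \<delta> powr (3 + 2 * \<beta>) * V \<le> R"
    using R by (simp add: ennreal_le_iff)
  moreover have "c * \<delta> powr (3 + 2 * \<beta>) * V = K * \<delta> powr (- e)"
  proof -
    have "V = L powr (- G) * L powr (- G) * (\<delta> powr (- G) * \<delta> powr (- G))"
      using L \<delta> by (simp add: V_def powr_mult)
    then have "c * \<delta> powr (3 + 2 * \<beta>) * V =
        K * (\<delta> powr (3 + 2 * \<beta>) * (\<delta> powr (- G) * \<delta> powr (- G)))"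
      by (simp add: K_def)
    also have "\<delta> powr (3 + 2 * \<beta>) * (\<delta> powr (- G) * \<delta> powr (- G)) =
        \<delta> powr (3 + 2 * \<beta> + (- G + - G))"
      by (simp only: powr_add)
    also have "3 + 2 * \<beta> + (- G + - G) = - e"
      by (simp add: e_def)
    finally show ?thesis .
  qed
  ultimately have KR: "K * \<delta> powr (- e) \<le> R"
    by simp
  have "K = K * \<delta> powr (- e) * \<delta> powr e"
    using \<delta>(1) by (simp add: powr_minus)
  also have "\<dots> \<le> R * \<delta> powr e"
    by (intro mult_right_mono KR) simp
  also have "\<dots> \<le> (R + 1) * \<delta> powr e"
    by (simp add: mult_right_mono)
  also have "\<dots> < K"
    using \<delta>(4) R by (simp add: field_simps)
  finally show False
    by simp
qed

theorem theorem2p4: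
  fixes p\<^sub>1 p\<^sub>2 :: "complex poly poly" and n\<^sub>1 m\<^sub>1 n\<^sub>2 m\<^sub>2 j\<^sub>1 j\<^sub>2 :: nat
    and \<alpha>\<^sub>1 \<alpha>\<^sub>2 \<tau>\<^sub>1 \<tau>\<^sub>2 :: complex and g\<^sub>1 g\<^sub>2 :: "nat \<Rightarrow> complex \<Rightarrow> complex"
    and J :: "complex set"
  assumes "rif_denominator n\<^sub>1 m\<^sub>1 p\<^sub>1" and "rif_denominator n\<^sub>2 m\<^sub>2 p\<^sub>2"
    and "\<alpha>\<^sub>1 \<in> circle" and "\<alpha>\<^sub>2 \<in> circle" and "\<tau>\<^sub>1 \<in> circle" and "\<tau>\<^sub>2 \<in> circle"
    and "level_set_parametrization (rif n\<^sub>1 m\<^sub>1 p\<^sub>1) \<alpha>\<^sub>1 \<tau>\<^sub>1 m\<^sub>1 g\<^sub>1"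
    and "level_set_parametrization (rif n\<^sub>2 m\<^sub>2 p\<^sub>2) \<alpha>\<^sub>2 \<tau>\<^sub>2 m\<^sub>2 g\<^sub>2"
    and "j\<^sub>1 \<in> {1..m\<^sub>1}" and "j\<^sub>2 \<in> {1..m\<^sub>2}"
    and "closed_arc J"
    and "\<forall>\<zeta>\<in>J. g\<^sub>1 j\<^sub>1 \<zeta> = g\<^sub>2 j\<^sub>2 \<zeta>"
    and "J \<inter> fst ` (rif_singularities p\<^sub>1 \<union> rif_singularities p\<^sub>2) = {}"
  shows "\<forall>\<beta>\<ge>-1. \<not> bounded_composition_operator \<beta>
           (\<lambda>z. (rif n\<^sub>1 m\<^sub>1 p\<^sub>1 z, rif n\<^sub>2 m\<^sub>2 p\<^sub>2 z))"
proof (intro allI impI notI)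
  fix \<beta> :: real
  define \<Phi> where "\<Phi> = (\<lambda>z. (rif n\<^sub>1 m\<^sub>1 p\<^sub>1 z, rif n\<^sub>2 m\<^sub>2 p\<^sub>2 z))"
  assume \<beta>: "-1 \<le> \<beta>" and bd: "bounded_composition_operator \<beta> (\<lambda>z. (rif n\<^sub>1 m\<^sub>1 p\<^sub>1 z, rif n\<^sub>2 m\<^sub>2 p\<^sub>2 z))"
  have J: "compact J" "J \<subseteq> circle"
    using assms(11) by (auto simp: closed_arc_def intro!: compact_continuous_image continuous_intros)
  \<comment> \<open>The arc avoids the first coordinates of all singularities, so the whole fibre
    over each of its points is free of zeros of both denominators.\<close>
  have p: "\<forall>\<zeta>\<in>J. \<forall>w\<in>circle. eval2 p\<^sub>1 (\<zeta>, w) \<noteq> 0"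
    "\<forall>\<zeta>\<in>J. \<forall>w\<in>circle. eval2 p\<^sub>2 (\<zeta>, w) \<noteq> 0"
  proof -
    have "(\<zeta>, w) \<notin> rif_singularities p\<^sub>1 \<union> rif_singularities p\<^sub>2" "(\<zeta>, w) \<in> bitorus"
      if "\<zeta> \<in> J" "w \<in> circle" for \<zeta> w
    proof -
      have "\<zeta> \<notin> fst ` (rif_singularities p\<^sub>1 \<union> rif_singularities p\<^sub>2)"
        using assms(13) that by blast
      then show "(\<zeta>, w) \<notin> rif_singularities p\<^sub>1 \<union> rif_singularities p\<^sub>2"
        by (metis fst_conv imageI)
      show "(\<zeta>, w) \<in> bitorus"
        using that J(2) by (auto simp: bitorus_def)
    qed
    then show "\<forall>\<zeta>\<in>J. \<forall>w\<in>circle. eval2 p\<^sub>1 (\<zeta>, w) \<noteq> 0"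
      "\<forall>\<zeta>\<in>J. \<forall>w\<in>circle. eval2 p\<^sub>2 (\<zeta>, w) \<noteq> 0"
      by (simp_all add: rif_singularities_def)
  qed
  define g where "g = g\<^sub>1 j\<^sub>1"
  have g: "\<forall>\<zeta>\<in>J. g \<zeta> \<in> circle"
    unfolding g_def by (intro ballI level_set_parametrizationD(1)[OF assms(7,9)]) (use J(2) in blast)
  have val: "\<forall>\<zeta>\<in>J. rif n\<^sub>1 m\<^sub>1 p\<^sub>1 (\<zeta>, g \<zeta>) = \<alpha>\<^sub>1" "\<forall>\<zeta>\<in>J. rif n\<^sub>2 m\<^sub>2 p\<^sub>2 (\<zeta>, g \<zeta>) = \<alpha>\<^sub>2"
  proof -
    have "rif n\<^sub>1 m\<^sub>1 p\<^sub>1 (\<zeta>, g \<zeta>) = \<alpha>\<^sub>1" "rif n\<^sub>2 m\<^sub>2 p\<^sub>2 (\<zeta>, g \<zeta>) = \<alpha>\<^sub>2" if \<zeta>: "\<zeta> \<in> J" for \<zeta>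
    proof -
      have \<zeta>c: "\<zeta> \<in> circle"
        using \<zeta> J(2) by blast
      have "g \<zeta> = g\<^sub>2 j\<^sub>2 \<zeta>"
        unfolding g_def using assms(12) \<zeta> by (rule bspec)
      then have lev: "(\<zeta>, g \<zeta>) \<in> level_set (rif n\<^sub>1 m\<^sub>1 p\<^sub>1) \<alpha>\<^sub>1"
        "(\<zeta>, g \<zeta>) \<in> level_set (rif n\<^sub>2 m\<^sub>2 p\<^sub>2) \<alpha>\<^sub>2"
        using level_set_parametrizationD(2)[OF assms(7,9) \<zeta>c]
          level_set_parametrizationD(2)[OF assms(8,10) \<zeta>c] by (simp_all add: g_def)
      note gc = bspec[OF g \<zeta>]
      show "rif n\<^sub>1 m\<^sub>1 p\<^sub>1 (\<zeta>, g \<zeta>) = \<alpha>\<^sub>1"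
        by (rule rif_eq_on_level_set[OF lev(1) bspec[OF bspec[OF p(1) \<zeta>] gc]])
      show "rif n\<^sub>2 m\<^sub>2 p\<^sub>2 (\<zeta>, g \<zeta>) = \<alpha>\<^sub>2"
        by (rule rif_eq_on_level_set[OF lev(2) bspec[OF bspec[OF p(2) \<zeta>] gc]])
    qed
    then show "\<forall>\<zeta>\<in>J. rif n\<^sub>1 m\<^sub>1 p\<^sub>1 (\<zeta>, g \<zeta>) = \<alpha>\<^sub>1" "\<forall>\<zeta>\<in>J. rif n\<^sub>2 m\<^sub>2 p\<^sub>2 (\<zeta>, g \<zeta>) = \<alpha>\<^sub>2"
      by blast+
  qed
  obtain L\<^sub>1 d\<^sub>1 where 1: "L\<^sub>1 > 0" "d\<^sub>1 > 0" "\<forall>\<delta>. 0 < \<delta> \<longrightarrow> \<delta> < d\<^sub>1 \<longrightarrow>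
    (\<forall>\<zeta>\<in>J. \<forall>z\<in>bidisc. cmod (fst z - \<zeta>) \<le> 3 * \<delta> \<longrightarrow> cmod (snd z - g \<zeta>) \<le> 3 * \<delta> \<longrightarrow>
      cmod (\<alpha>\<^sub>1 - rif n\<^sub>1 m\<^sub>1 p\<^sub>1 z) \<le> L\<^sub>1 * \<delta>)"
    using rif_near_level_curve[OF J assms(3) p(1) g val(1)] by (elim exE conjE) (rule that)
  obtain L\<^sub>2 d\<^sub>2 where 2: "L\<^sub>2 > 0" "d\<^sub>2 > 0" "\<forall>\<delta>. 0 < \<delta> \<longrightarrow> \<delta> < d\<^sub>2 \<longrightarrow>
    (\<forall>\<zeta>\<in>J. \<forall>z\<in>bidisc. cmod (fst z - \<zeta>) \<le> 3 * \<delta> \<longrightarrow> cmod (snd z - g \<zeta>) \<le> 3 * \<delta> \<longrightarrow>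
      cmod (\<alpha>\<^sub>2 - rif n\<^sub>2 m\<^sub>2 p\<^sub>2 z) \<le> L\<^sub>2 * \<delta>)"
    using rif_near_level_curve[OF J assms(4) p(2) g val(2)] by (elim exE conjE) (rule that)
  obtain a l where al: "0 \<le> a" "a + l \<le> 2 * pi" "0 < l" "l \<le> 1" "cis ` {a..a + l} \<subseteq> J"
    using closed_arc_contains_normalized[OF assms(11)] by blast
  obtain G where G: "G > \<beta> + 3/2" "peak G \<alpha>\<^sub>1 \<alpha>\<^sub>2 \<in> A2 \<beta>"
    using peak_in_A2[OF assms(3,4) \<beta>] by blast
  have "A2_norm_sq \<beta> (peak G \<alpha>\<^sub>1 \<alpha>\<^sub>2 \<circ> \<Phi>) = \<infinity>"
  \<comment> \<open>The larger Lipschitz constant and the smaller threshold serve both components of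
    \<Phi> along the common curve.\<close>
  proof (rule peak_comp_norm_infinite[OF assms(3,4) \<beta> G(1) al(1-4), of "\<lambda>s. g (cis s)" _ "max L\<^sub>1 L\<^sub>2" "min d\<^sub>1 d\<^sub>2"])
    show "\<Phi> z \<in> bidisc" if "z \<in> bidisc" for z
      using composition_maps_bidisc[OF bd that] by (simp add: \<Phi>_def)
    show "0 < max L\<^sub>1 L\<^sub>2" "0 < min d\<^sub>1 d\<^sub>2"
      using 1(1,2) 2(1,2) by auto
    show "g (cis s) \<in> circle" if "s \<in> {a..a + l}" for s
      using g al(5) that by blast
    fix \<delta> s z
    assume *: "0 < \<delta>" "\<delta> < min d\<^sub>1 d\<^sub>2" "s \<in> {a..a + l}" "z \<in> bidisc"
      "cmod (fst z - cis s) \<le> 3 * \<delta>" "cmod (snd z - g (cis s)) \<le> 3 * \<delta>"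
    have "cis s \<in> J"
      using al(5) *(3) by blast
    then have "cmod (\<alpha>\<^sub>1 - fst (\<Phi> z)) \<le> L\<^sub>1 * \<delta>" "cmod (\<alpha>\<^sub>2 - snd (\<Phi> z)) \<le> L\<^sub>2 * \<delta>"
      using 1(3)[rule_format, OF *(1) _ _ *(4-6)] 2(3)[rule_format, OF *(1) _ _ *(4-6)] *(2) by (simp_all add: \<Phi>_def)
    moreover have "L\<^sub>1 * \<delta> \<le> max L\<^sub>1 L\<^sub>2 * \<delta>" "L\<^sub>2 * \<delta> \<le> max L\<^sub>1 L\<^sub>2 * \<delta>"
      using *(1) by (auto intro!: mult_right_mono)
    ultimately show "cmod (\<alpha>\<^sub>1 - fst (\<Phi> z)) \<le> max L\<^sub>1 L\<^sub>2 * \<delta> \<and> cmod (\<alpha>\<^sub>2 - snd (\<Phi> z)) \<le> max L\<^sub>1 L\<^sub>2 * \<delta>"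
      by linarith
  qed
  moreover have "peak G \<alpha>\<^sub>1 \<alpha>\<^sub>2 \<circ> \<Phi> \<in> A2 \<beta>"
    using bd G(2) unfolding bounded_composition_operator_def \<Phi>_def by blast
  ultimately show False
    by (simp add: A2_def)
qed

end
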